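(* Let $n\geq 2$, let $k$ be an arbitrary field and $\underline x=(x_1,\ldots,x_n)$. Let $(A_1,B_1),\ldots,(A_s,B_s)$ be $s$ pairs of nonzero relatively prime polynomials in $k[\underline x]$. Then there is an integer $d_0\geq 1$ with this property: for all integers $d_1,\ldots,d_n$ larger than $d_0$, there exists an irreducible polynomial $M\in k[\underline x]$ such that $A_i+B_iM$ is irreducible in $k[\underline x]$ for $i=1,\ldots,s$, and $\deg_{x_j}(M)=d_j$ for $j=1,\ldots,n$.
   Context: In each pair $(A_i,B_i)$, both polynomials are nonzero and $A_i$ and $B_i$ are relatively prime to each other in the UFD $k[\underline x]$. *)

theory Defs
  imports
    "HOL-Library.Poly_Mapping"
    "HOL-Computational_Algebra.Factorial_Ring"
    "HOL-Library.Cardinality"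
begin

(* A monomial maps each variable to its exponent, a polynomial maps each monomial to its
   coefficient; both are finitely supported.  For a finite type 'n with CARD('n) = n, the ring
   operations of Poly_Mapping make this type the ring k[x_1, ..., x_n], with the elements of 'n
   as variables. *)
type_synonym ('n, 'k) mvpoly = "('n \<Rightarrow>\<^sub>0 nat) \<Rightarrow>\<^sub>0 'k"

(* Inserting 0 only fixes the degree of the zero polynomial to be 0. *)
definition deg_in :: "'n \<Rightarrow> ('n, 'k::zero) mvpoly \<Rightarrow> nat" where
  "deg_in j p = Max (insert 0 ((\<lambda>m. Poly_Mapping.lookup m j) ` Poly_Mapping.keys p))"

(* The constant coprime of HOL.Rings lives in class algebraic_semidom, whose division operation
   is not available on poly_mapping.  This is the same definition, without the need for division. *)
definition rel_prime :: "'a::comm_semiring_1 \<Rightarrow> 'a \<Rightarrow> bool" where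
  "rel_prime a b \<longleftrightarrow> (\<forall>c. c dvd a \<longrightarrow> c dvd b \<longrightarrow> c dvd 1)"

lemma rel_prime_eq_coprime: "rel_prime a b \<longleftrightarrow> coprime a (b :: 'a :: algebraic_semidom)"
  by (simp add: rel_prime_def coprime_def)

end

theory Submission
  imports Defs
begin

text \<open>
  Choose two variables \<open>x \<noteq> y\<close> with \<open>e = d\<^sub>x \<ge> d = d\<^sub>y\<close>, let \<open>z\<close> be the
  product of the powers \<open>x\<^sub>j ^ d\<^sub>j\<close> of the other variables, and take
  \<open>M = y ^ d + x ^ e z y ^ (d - 1) + x ^ c\<close> with \<open>c = e - (d - 1) + q\<close>, where \<open>q\<close> is
  large compared with the \<open>A\<^sub>i\<close>, \<open>B\<^sub>i\<close> but small compared with \<open>d\<close>.  Suppose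
  \<open>A + B M = F G\<close>.  As in Perron's criterion, \<open>A + B M\<close>, as a polynomial in \<open>y\<close>, has
  one root of large degree in \<open>x\<close>.  The factor without this root, say \<open>G\<close>, has bounded degree
  in \<open>x\<close>; since almost all other roots have degree about \<open>-1\<close> and the \<open>y\<close>-free part of \<open>G\<close>
  does not vanish, its degree in \<open>y\<close> is bounded as well.  Now \<open>G\<close> is prime to \<open>B\<close>, so
  Gauss's lemma gives a relation \<open>r = u G + v B\<close> with \<open>r \<noteq> 0\<close> free of \<open>y\<close> and of
  bounded degree, whence \<open>G\<close> divides \<open>v A + r M\<close>.  Here \<open>v A\<close> is negligible, and the edge of
  the Newton polygon that belongs to \<open>x ^ e z y ^ (d - 1) + x ^ c\<close> has slope
  \<open>-1 + q / (d - 1)\<close>; a factor of \<open>y\<close>-degree \<open>g > 0\<close> inherits it, so that \<open>d - 1\<close>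
  divides \<open>g q\<close>, which is too small.  All Newton polygon arguments are carried out with integer
  weights of monomials: the maximal weight of a product is the sum of the maximal weights of the
  factors.
\<close>

subsection \<open>Products and degrees\<close>

abbreviation "lookup \<equiv> Poly_Mapping.lookup"
abbreviation "keys \<equiv> Poly_Mapping.keys"
abbreviation "single \<equiv> Poly_Mapping.single"

lemma keys_eq_empty_iff [simp]: "keys p = {} \<longleftrightarrow> p = 0"
  by (auto intro!: poly_mapping_eqI simp: keys.rep_eq)

text \<open>Only pairs of keys contribute to the convolution sum, and the assumption leaves at most
  the pair \<open>(m, n)\<close>.\<close>

lemma lookup_mult_unique:
  fixes p q :: "'m::cancel_comm_monoid_add \<Rightarrow>\<^sub>0 'k::comm_semiring_1"
  assumes "\<And>a b. a \<in> keys p \<Longrightarrow> b \<in> keys q \<Longrightarrow> a + b = m + n \<Longrightarrow> a = m \<and> b = n"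
  shows "lookup (p * q) (m + n) = lookup p m * lookup q n"
proof -
  have "lookup (p * q) (m + n)
      = (\<Sum>(a, b). lookup p a * lookup q b when m + n = a + b)"
    by (simp add: times_poly_mapping.rep_eq prod_fun_unfold_prod)
  also have "\<dots> = (\<Sum>x. (case x of (a, b) \<Rightarrow> lookup p a * lookup q b) when x = (m, n))"
  proof (rule Sum_any.cong)
    fix x :: "'m \<times> 'm"
    obtain a b where x: "x = (a, b)" by force
    show "(case x of (a, b) \<Rightarrow> lookup p a * lookup q b when m + n = a + b)
        = ((case x of (a, b) \<Rightarrow> lookup p a * lookup q b) when x = (m, n))"
      using assms[of a b] by (cases "lookup p a = 0"; cases "lookup q b = 0")
        (auto simp: x when_def in_keys_iff)
  qed
  also have "\<dots> = lookup p m * lookup q n"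
    by simp
  finally show ?thesis .
qed

lemma lookup_mult_single [simp]:
  fixes p :: "('n \<Rightarrow>\<^sub>0 nat) \<Rightarrow>\<^sub>0 'k::comm_semiring_1"
  shows "lookup (p * single n c) (m + n) = lookup p m * c"
  by (subst lookup_mult_unique) (auto split: if_splits)

lemma keys_mult_single:
  fixes p :: "('n \<Rightarrow>\<^sub>0 nat) \<Rightarrow>\<^sub>0 'k::comm_semiring_1"
  shows "keys (p * single n c) \<subseteq> (\<lambda>m. m + n) ` keys p"
  using keys_mult[of p "single n c"] by (auto split: if_splits)

text \<open>The library knows \<open>mvpoly\<close> to be an integral domain only if the variables are linearly
  ordered; the embedding into exponents of variables indexed by \<open>nat\<close> supplies a monomial order.\<close>

lemma ex_linorder_embedding:
  "\<exists>f :: ('n::finite \<Rightarrow>\<^sub>0 nat) \<Rightarrow> (nat \<Rightarrow>\<^sub>0 nat).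
     inj f \<and> (\<forall>a b. f (a + b) = f a + f b)"
proof -
  obtain h :: "'n \<Rightarrow> nat" where h: "inj h"
    using finite_imp_inj_to_nat_seg[OF finite] by metis
  define f :: "('n \<Rightarrow>\<^sub>0 nat) \<Rightarrow> (nat \<Rightarrow>\<^sub>0 nat)"
    where "f m = (\<Sum>j\<in>UNIV. single (h j) (lookup m j))" for m
  have l: "lookup (f m) (h i) = lookup m i" for m i
    using h by (simp add: f_def lookup_sum lookup_single when_def inj_eq)
  have "inj f"
    by (rule injI, rule poly_mapping_eqI) (metis l)
  moreover have "f (a + b) = f a + f b" for a b
    by (simp add: f_def lookup_add single_add sum.distrib)
  ultimately show ?thesis by blast
qed

text \<open>In each factor take, among the monomials of maximal weight, the largest one in the
  monomial order. The product of these two monomials arises in one way only, so it cannot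
  cancel.\<close>

lemma keys_mult_max:
  fixes p q :: "('n::finite, 'k::idom) mvpoly" and W :: "('n \<Rightarrow>\<^sub>0 nat) \<Rightarrow> int"
  assumes W: "\<And>a b. W (a + b) = W a + W b"
    and "p \<noteq> 0" "q \<noteq> 0"
  obtains m n where "m \<in> keys p" "n \<in> keys q" "m + n \<in> keys (p * q)"
    "\<And>a. a \<in> keys p \<Longrightarrow> W a \<le> W m" "\<And>b. b \<in> keys q \<Longrightarrow> W b \<le> W n"
proof -
  obtain f :: "('n \<Rightarrow>\<^sub>0 nat) \<Rightarrow> (nat \<Rightarrow>\<^sub>0 nat)"
    where f: "inj f" and add: "\<And>a b. f (a + b) = f a + f b"
    using ex_linorder_embedding by blast
  have top: "\<exists>m\<in>keys r. (\<forall>a\<in>keys r. W a \<le> W m) \<and> (\<forall>a\<in>keys r. W a = W m \<longrightarrow> f a \<le> f m)"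
    if "r \<noteq> 0" for r :: "('n, 'k) mvpoly"
  proof -
    have ne: "keys r \<noteq> {}" using that by simp
    define t where "t = Max (W ` keys r)"
    have t: "\<And>a. a \<in> keys r \<Longrightarrow> W a \<le> t" "t \<in> W ` keys r"
      using ne by (auto simp: t_def intro!: Max_in)
    define S where "S = {a \<in> keys r. W a = t}"
    have S: "finite S" "S \<noteq> {}" using t(2) by (auto simp: S_def)
    obtain m where m: "m \<in> S" "f m = Max (f ` S)"
      using Max_in[of "f ` S"] S by fastforce
    have "f a \<le> f m" if "a \<in> S" for a using m S that by simp
    then show ?thesis using m(1) t(1) by (auto simp: S_def intro!: bexI[of _ m])
  qed
  obtain m where m: "m \<in> keys p" "\<And>a. a \<in> keys p \<Longrightarrow> W a \<le> W m"
     "\<And>a. a \<in> keys p \<Longrightarrow> W a = W m \<Longrightarrow> f a \<le> f m"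
    using top[OF assms(2)] by blast
  obtain n where n: "n \<in> keys q" "\<And>a. a \<in> keys q \<Longrightarrow> W a \<le> W n"
     "\<And>a. a \<in> keys q \<Longrightarrow> W a = W n \<Longrightarrow> f a \<le> f n"
    using top[OF assms(3)] by blast
  have "a = m \<and> b = n" if "a \<in> keys p" "b \<in> keys q" "a + b = m + n" for a b
  proof -
    have "W a + W b = W m + W n" using that(3) W by metis
    then have "W a = W m" "W b = W n" using m(2)[OF that(1)] n(2)[OF that(2)] by auto
    then have le: "f a \<le> f m" "f b \<le> f n" using m(3) n(3) that by auto
    have eq: "f a + f b = f m + f n" using that(3) add by metis
    have "f a = f m"
      using le eq by (metis add_less_le_mono order_le_less less_irrefl)
    then show ?thesis using eq f by (metis add_left_cancel inj_eq)
  qed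
  then have "lookup (p * q) (m + n) = lookup p m * lookup q n"
    by (rule lookup_mult_unique)
  then have "m + n \<in> keys (p * q)" using m(1) n(1) by (simp add: in_keys_iff)
  with m n that show thesis by blast
qed

text \<open>Already for the zero weight, \<open>keys_mult_max\<close> exhibits a monomial of the
  product.\<close>

lemma mvpoly_mult_eq_0_iff [simp]:
  fixes p q :: "('n::finite, 'k::idom) mvpoly"
  shows "p * q = 0 \<longleftrightarrow> p = 0 \<or> q = 0"
  using keys_mult_max[of "\<lambda>_. 0" p q] by fastforce

lemma mvpoly_mult_left_cancel:
  fixes p q r :: "('n::finite, 'k::idom) mvpoly"
  assumes "p * q = p * r" "p \<noteq> 0"
  shows "q = r"
proof -
  have "p * (q - r) = 0" using assms(1) by (simp add: algebra_simps)
  then show ?thesis using assms(2) by simp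
qed

text \<open>The form in which weights are used below: \<open>m + n\<close> itself may cancel, but
  the maximal weights of the two factors add up to a weight that occurs in the product.\<close>

lemma keys_mult_bound:
  fixes p q :: "('n::finite, 'k::idom) mvpoly" and W :: "('n \<Rightarrow>\<^sub>0 nat) \<Rightarrow> int"
  assumes W: "\<And>a b. W (a + b) = W a + W b"
    and "m \<in> keys p" "n \<in> keys q" "\<And>k. k \<in> keys (p * q) \<Longrightarrow> W k \<le> t"
  shows "W m + W n \<le> t"
proof -
  have "p \<noteq> 0" "q \<noteq> 0" using assms by auto
  then obtain m' n' where "m' + n' \<in> keys (p * q)" "W m \<le> W m'" "W n \<le> W n'"
    using keys_mult_max[of W p q] assms by metis
  then show ?thesis using assms(4)[of "m' + n'"] W[of m' n'] by linarith
qed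

lemma keys_mult_split:
  fixes p q :: "('n::finite, 'k::idom) mvpoly"
  assumes "k \<in> keys (p * q)"
  obtains m n where "m \<in> keys p" "n \<in> keys q" "k = m + n"
  using assms keys_mult[of p q] by blast

section \<open>The degree in one variable\<close>

lemma deg_in_le_iff: "deg_in j p \<le> n \<longleftrightarrow> (\<forall>m\<in>keys p. lookup m j \<le> n)"
  by (simp add: deg_in_def)

lemma le_deg_in: "m \<in> keys p \<Longrightarrow> lookup m j \<le> deg_in j p"
  using deg_in_le_iff[of j p "deg_in j p"] by auto

lemma deg_in_attained:
  assumes "p \<noteq> 0"
  obtains m where "m \<in> keys p" "lookup m j = deg_in j p"
proof -
  have ne: "keys p \<noteq> {}" using assms by simp
  then have "deg_in j p = Max ((\<lambda>m. lookup m j) ` keys p)"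
    by (simp add: deg_in_def Max_insert)
  then have "deg_in j p \<in> (\<lambda>m. lookup m j) ` keys p" using ne by simp
  then show thesis using that by auto
qed

lemma deg_in_0 [simp]: "deg_in j 0 = 0"
  by (simp add: deg_in_def)

lemma deg_in_1 [simp]: "deg_in j (1 :: ('n, 'k::zero_neq_one) mvpoly) = 0"
  by (simp add: deg_in_def)

lemma deg_in_single: "deg_in j (single m c) = (if c = 0 then 0 else lookup m j)"
  by (simp add: deg_in_def)

lemma deg_in_add:
  fixes p q :: "('n, 'k::comm_monoid_add) mvpoly"
  assumes "deg_in j p \<le> n" "deg_in j q \<le> n" shows "deg_in j (p + q) \<le> n"
  using assms keys_add[of p q] by (auto simp: deg_in_le_iff)

lemma deg_in_uminus [simp]:
  fixes p :: "('n, 'k::ab_group_add) mvpoly"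
  shows "deg_in j (- p) = deg_in j p"
  by (simp add: deg_in_def keys.rep_eq)

lemma deg_in_diff:
  fixes p q :: "('n, 'k::ab_group_add) mvpoly"
  assumes "deg_in j p \<le> n" "deg_in j q \<le> n" shows "deg_in j (p - q) \<le> n"
  using deg_in_add[of j p n "- q"] assms by simp

text \<open>The exponent of \<open>j\<close> is an additive weight, so the top degrees cannot
  cancel.\<close>

lemma deg_in_mult:
  fixes p q :: "('n::finite, 'k::idom) mvpoly"
  assumes "p \<noteq> 0" "q \<noteq> 0"
  shows "deg_in j (p * q) = deg_in j p + deg_in j q"
proof (rule antisym)
  have "lookup (a + b) j \<le> deg_in j p + deg_in j q" if "a \<in> keys p" "b \<in> keys q" for a b
    using that by (simp add: lookup_add add_mono le_deg_in)
  then show "deg_in j (p * q) \<le> deg_in j p + deg_in j q"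
    unfolding deg_in_le_iff using keys_mult_split by metis
  obtain m n where "m \<in> keys p" "lookup m j = deg_in j p" "n \<in> keys q" "lookup n j = deg_in j q"
    using deg_in_attained assms by metis
  then show "deg_in j p + deg_in j q \<le> deg_in j (p * q)"
    using keys_mult_bound[of "\<lambda>m. int (lookup m j)" m p n q "int (deg_in j (p * q))"]
    by (simp add: lookup_add le_deg_in)
qed

lemma deg_in_mult_le:
  fixes p q :: "('n::finite, 'k::idom) mvpoly"
  shows "deg_in j (p * q) \<le> deg_in j p + deg_in j q"
  by (cases "p = 0 \<or> q = 0") (auto simp: deg_in_mult)

lemma deg_in_dvd:
  fixes p q :: "('n::finite, 'k::idom) mvpoly"
  assumes "p dvd q" "q \<noteq> 0"
  shows "deg_in j p \<le> deg_in j q"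
  using assms by (auto simp: deg_in_mult elim!: dvdE)

text \<open>Degree 0 in every variable leaves only a constant, and nonzero constants are invertible
  over a field. Conversely, a divisor of 1 has no larger degrees than 1.\<close>

lemma unit_iff_deg_in_0:
  fixes p :: "('n::finite, 'k::field) mvpoly"
  shows "p dvd 1 \<longleftrightarrow> p \<noteq> 0 \<and> (\<forall>j. deg_in j p = 0)"
proof
  assume p: "p dvd 1"
  then show "p \<noteq> 0 \<and> (\<forall>j. deg_in j p = 0)"
    using deg_in_dvd[of p 1] by (auto dest: dvd_0_left)
next
  assume p: "p \<noteq> 0 \<and> (\<forall>j. deg_in j p = 0)"
  then have k: "keys p \<subseteq> {0}" using le_deg_in[of _ p]
    by (auto intro!: poly_mapping_eqI)
  have "p = single 0 (lookup p 0)"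
    by (rule poly_mapping_eqI) (use k in \<open>auto simp: lookup_single when_def in_keys_iff\<close>)
  moreover from this have "lookup p 0 \<noteq> 0" using p by (metis single_zero)
  ultimately have "p * single 0 (inverse (lookup p 0)) = 1"
    by (metis mult_single add_0 right_inverse single_one)
  then show "p dvd 1" by (metis dvd_triv_left)
qed

subsection \<open>Coefficients with respect to one variable\<close>

text \<open>The coefficient of \<open>y ^ n\<close> when \<open>p\<close> is read as a polynomial in
  \<open>y\<close>. It stays in the same type, as a polynomial free of \<open>y\<close>.\<close>

definition coeff_in :: "'n \<Rightarrow> nat \<Rightarrow> ('n, 'k::zero) mvpoly \<Rightarrow> ('n, 'k) mvpoly" where
  "coeff_in y n p = Abs_poly_mapping (\<lambda>m. lookup p (m + single y n) when lookup m y = 0)"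

definition lead_in :: "'n \<Rightarrow> ('n, 'k::zero) mvpoly \<Rightarrow> ('n, 'k) mvpoly" where
  "lead_in y p = coeff_in y (deg_in y p) p"

abbreviation var_pow :: "'n \<Rightarrow> nat \<Rightarrow> ('n, 'k::zero_neq_one) mvpoly" where
  "var_pow y n \<equiv> single (single y n) 1"

text \<open>Degree less than \<open>n\<close> in \<open>y\<close>, where unlike for \<open>deg_in\<close> the zero polynomial has degree
  \<open>-\<infinity>\<close>.\<close>

definition below :: "'n \<Rightarrow> nat \<Rightarrow> ('n, 'k::zero) mvpoly \<Rightarrow> bool" where
  "below y n p \<longleftrightarrow> (\<forall>m\<in>keys p. lookup m y < n)"

lemma lookup_coeff_in:
  "lookup (coeff_in y n p) m = (lookup p (m + single y n) when lookup m y = 0)"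
proof -
  have "finite ((\<lambda>m. m + single y n) -` keys p)"
    by (rule finite_vimageI) (auto simp: inj_on_def)
  then have "finite {m. (lookup p (m + single y n) when lookup m y = 0) \<noteq> 0}"
    by (rule rev_finite_subset) (auto simp: in_keys_iff)
  then show ?thesis by (simp add: coeff_in_def)
qed

lemma below_0 [simp]: "below y n 0"
  by (simp add: below_def)

lemma below_0_iff: "below y 0 p \<longleftrightarrow> p = 0"
  by (simp add: below_def)

lemma below_Suc_deg_in: "below y (Suc (deg_in y p)) p"
  by (simp add: below_def le_deg_in less_Suc_eq_le)

lemma deg_in_less_iff_below: "0 < n \<Longrightarrow> deg_in y p < n \<longleftrightarrow> below y n p"
  by (cases n) (auto simp: less_Suc_eq_le deg_in_le_iff below_def)

lemma below_add:
  fixes p q :: "('n, 'k::comm_monoid_add) mvpoly"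
  shows "below y n p \<Longrightarrow> below y n q \<Longrightarrow> below y n (p + q)"
  using keys_add[of p q] by (auto simp: below_def)

lemma below_diff:
  fixes p q :: "('n, 'k::ab_group_add) mvpoly"
  shows "below y n p \<Longrightarrow> below y n q \<Longrightarrow> below y n (p - q)"
  using keys_add[of p "- q"] by (auto simp: below_def keys.rep_eq)

lemma below_mono: "below y n p \<Longrightarrow> n \<le> k \<Longrightarrow> below y k p"
  by (auto simp: below_def)

lemma below_mult:
  fixes p q :: "('n, 'k::comm_ring_1) mvpoly"
  assumes "below y n p" "deg_in y q \<le> k"
  shows "below y (n + k) (p * q)"
  using assms keys_mult[of p q]
  by (fastforce simp: below_def lookup_add deg_in_le_iff intro: add_less_le_mono)

lemma below_mult':
  fixes p q :: "('n, 'k::comm_ring_1) mvpoly"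
  assumes "below y n q" "deg_in y p \<le> k"
  shows "below y (k + n) (p * q)"
  using below_mult[of y n q p k] assms by (simp add: mult.commute add.commute)

lemma deg_in_coeff_in [simp]: "deg_in y (coeff_in y n p) = 0"
  using deg_in_le_iff[of y "coeff_in y n p" 0] by (simp add: in_keys_iff lookup_coeff_in)

lemma deg_in_coeff_in_le: "deg_in j (coeff_in y n p) \<le> deg_in j p"
  unfolding deg_in_le_iff
proof
  fix m assume "m \<in> keys (coeff_in y n p)"
  then have "m + single y n \<in> keys p" by (auto simp: in_keys_iff lookup_coeff_in)
  from le_deg_in[OF this, of j] show "lookup m j \<le> deg_in j p" by (simp add: lookup_add)
qed

lemma deg_in_lead_in [simp]: "deg_in y (lead_in y p) = 0"
  by (simp add: lead_in_def)

lemma deg_in_lead_in_le: "deg_in j (lead_in y p) \<le> deg_in j p"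
  by (simp add: lead_in_def deg_in_coeff_in_le)

lemma deg_in_var_pow: "deg_in j (var_pow y n) = (if j = y then n else 0)"
  by (auto simp: deg_in_single lookup_single when_def)

lemma below_coeff_in:
  fixes p :: "('n, 'k::comm_ring_1) mvpoly"
  assumes "below y (Suc n) p"
  shows "below y n (p - coeff_in y n p * var_pow y n)"
  unfolding below_def
proof (intro ballI, rule ccontr)
  fix m assume m: "m \<in> keys (p - coeff_in y n p * var_pow y n)" and "\<not> lookup m y < n"
  define a where "a = m - single y n"
  have ma: "m = a + single y n"
    using \<open>\<not> lookup m y < n\<close>
    by (auto simp: a_def lookup_add lookup_minus lookup_single when_def intro!: poly_mapping_eqI)
  have *: "lookup p m - lookup (coeff_in y n p) a \<noteq> 0"
    using m by (simp add: in_keys_iff lookup_minus) (simp add: ma)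
  \<comment> \<open>If \<open>a\<close> is free of \<open>y\<close>, the two coefficients cancel;
    otherwise \<open>m\<close> is a monomial of \<open>p\<close> of degree greater than
    \<open>n\<close> in \<open>y\<close>.\<close>
  have "lookup a y \<noteq> 0"
  proof
    assume "lookup a y = 0"
    then show False using * by (simp add: lookup_coeff_in ma)
  qed
  then have "lookup (coeff_in y n p) a = 0" "lookup m y > n"
    by (auto simp: lookup_coeff_in ma lookup_add)
  with * have "m \<in> keys p" by (simp add: in_keys_iff)
  with assms \<open>lookup m y > n\<close> show False by (auto simp: below_def)
qed

lemma coeff_in_top:
  fixes l r :: "('n, 'k::comm_ring_1) mvpoly"
  assumes "deg_in y l = 0" "below y n r"
  shows "coeff_in y n (l * var_pow y n + r) = l"
proof (rule poly_mapping_eqI)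
  fix m
  have "lookup l m = 0" if "lookup m y \<noteq> 0"
    using that assms(1) le_deg_in[of m l y] by (auto simp: in_keys_iff)
  moreover have "lookup r (m + single y n) = 0"
  proof (rule ccontr)
    assume "lookup r (m + single y n) \<noteq> 0"
    then have "m + single y n \<in> keys r" by (simp add: in_keys_iff)
    then have "lookup (m + single y n) y < n" using assms(2) by (simp add: below_def)
    then show False by (simp add: lookup_add)
  qed
  ultimately show "lookup (coeff_in y n (l * var_pow y n + r)) m = lookup l m"
    by (auto simp: lookup_coeff_in lookup_add when_def)
qed

lemma
  fixes l r :: "('n, 'k::comm_ring_1) mvpoly"
  assumes "deg_in y l = 0" "l \<noteq> 0" "below y n r"
  shows deg_in_top: "deg_in y (l * var_pow y n + r) = n"
    and lead_in_top: "lead_in y (l * var_pow y n + r) = l"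
proof -
  have c: "coeff_in y n (l * var_pow y n + r) = l"
    using assms by (intro coeff_in_top)
  have "n \<le> deg_in y (l * var_pow y n + r)"
  proof -
    obtain m where "m \<in> keys l" using assms(2) keys_eq_empty_iff by blast
    then have "m + single y n \<in> keys (l * var_pow y n + r)"
      using c by (metis in_keys_iff lookup_coeff_in when_neq_zero)
    from le_deg_in[OF this, of y] show ?thesis by (simp add: lookup_add)
  qed
  moreover have "deg_in y (l * var_pow y n + r) \<le> n"
  proof (rule deg_in_add)
    have "below y (Suc 0 + n) (l * var_pow y n)"
      using assms below_Suc_deg_in[of y l] by (intro below_mult) (auto simp: deg_in_var_pow)
    then show "deg_in y (l * var_pow y n) \<le> n"
      by (simp add: deg_in_less_iff_below[symmetric] less_Suc_eq_le)
    show "deg_in y r \<le> n"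
      using assms(3) by (auto simp: deg_in_le_iff below_def intro: less_imp_le)
  qed
  ultimately show "deg_in y (l * var_pow y n + r) = n" by simp
  with c show "lead_in y (l * var_pow y n + r) = l" by (simp add: lead_in_def)
qed

lemma below_lead_in:
  fixes p :: "('n, 'k::comm_ring_1) mvpoly"
  shows "below y (deg_in y p) (p - lead_in y p * var_pow y (deg_in y p))"
  unfolding lead_in_def by (rule below_coeff_in) (rule below_Suc_deg_in)

lemma lead_in_0 [simp]: "lead_in y 0 = 0"
  by (rule poly_mapping_eqI) (simp add: lead_in_def lookup_coeff_in)

lemma lead_in_eq_0_iff [simp]:
  fixes p :: "('n, 'k::comm_ring_1) mvpoly"
  shows "lead_in y p = 0 \<longleftrightarrow> p = 0"
proof
  assume "lead_in y p = 0"
  then have b: "below y (deg_in y p) p" using below_lead_in[of y p] by simp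
  show "p = 0"
    using deg_in_attained[of p y] b by (fastforce simp: below_def)
qed simp

lemma lead_in_deg_0:
  fixes p :: "('n, 'k::comm_ring_1) mvpoly"
  assumes "deg_in y p = 0"
  shows "lead_in y p = p"
  using below_lead_in[of y p] assms by (simp add: below_0_iff)

text \<open>Split off the leading term of each factor: all other products have smaller degree in
  \<open>y\<close>, and the product of the leading coefficients is not zero.\<close>

lemma lead_in_mult:
  fixes p q :: "('n::finite, 'k::idom) mvpoly"
  shows "lead_in y (p * q) = lead_in y p * lead_in y q"
proof (cases "p = 0 \<or> q = 0")
  case False
  define a b where "a = deg_in y p" and "b = deg_in y q"
  define p' q' where "p' = p - lead_in y p * var_pow y a" and "q' = q - lead_in y q * var_pow y b"
  have b: "below y a p'" "below y b q'"
    by (auto simp: a_def b_def p'_def q'_def below_lead_in)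
  have "p * q = lead_in y p * lead_in y q * var_pow y (a + b)
      + (p' * q + lead_in y p * var_pow y a * q')"
  proof -
    have "(var_pow y (a + b) :: ('n, 'k) mvpoly) = var_pow y a * var_pow y b"
      by (simp add: mult_single single_add)
    then show ?thesis by (simp add: p'_def q'_def algebra_simps)
  qed
  moreover have "below y (a + b) (p' * q + lead_in y p * var_pow y a * q')"
  proof (rule below_add)
    show "below y (a + b) (p' * q)" using b by (intro below_mult) (auto simp: b_def)
    have "deg_in y (lead_in y p * var_pow y a) \<le> 0 + a"
      using deg_in_mult_le[of y "lead_in y p" "var_pow y a"] by (simp add: deg_in_var_pow)
    then show "below y (a + b) (lead_in y p * var_pow y a * q')"
      using b by (intro below_mult') auto
  qed
  moreover have "deg_in y (lead_in y p * lead_in y q) = 0"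
    using deg_in_mult_le[of y "lead_in y p" "lead_in y q"] by simp
  ultimately show ?thesis using lead_in_top[of y "lead_in y p * lead_in y q"] False by simp
qed auto

subsection \<open>Unique factorization\<close>

text \<open>Polynomial rings in fewer variables are represented as subrings of one fixed
  type.\<close>

definition vars_in :: "'n set \<Rightarrow> ('n, 'k::zero) mvpoly \<Rightarrow> bool" where
  "vars_in V p \<longleftrightarrow> (\<forall>j. j \<notin> V \<longrightarrow> deg_in j p = 0)"

lemma vars_in_simps [simp]: "vars_in UNIV p" "vars_in V 0" "vars_in V (1 :: ('n, 'k::zero_neq_one) mvpoly)"
  by (auto simp: vars_in_def)

lemma vars_in_add:
  fixes p q :: "('n, 'k::comm_monoid_add) mvpoly"
  shows "vars_in V p \<Longrightarrow> vars_in V q \<Longrightarrow> vars_in V (p + q)"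
  using deg_in_add[of _ p 0 q] by (simp add: vars_in_def)

lemma vars_in_diff:
  fixes p q :: "('n, 'k::ab_group_add) mvpoly"
  shows "vars_in V p \<Longrightarrow> vars_in V q \<Longrightarrow> vars_in V (p - q)"
  using deg_in_diff[of _ p 0 q] by (simp add: vars_in_def)

lemma vars_in_mult:
  fixes p q :: "('n::finite, 'k::idom) mvpoly"
  shows "vars_in V p \<Longrightarrow> vars_in V q \<Longrightarrow> vars_in V (p * q)"
  using deg_in_mult_le[of _ p q] by (auto simp: vars_in_def) (metis add_0 le_zero_eq)

lemma vars_in_factor:
  fixes p q :: "('n::finite, 'k::idom) mvpoly"
  shows "vars_in V (p * q) \<Longrightarrow> p \<noteq> 0 \<Longrightarrow> vars_in V q"
  by (cases "q = 0") (auto simp: vars_in_def deg_in_mult)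

lemma vars_in_coeff_in: "vars_in V p \<Longrightarrow> vars_in (V - {y}) (coeff_in y n p)"
  using deg_in_coeff_in_le[of _ y n p] by (auto simp: vars_in_def) (metis le_zero_eq)

lemma vars_in_lead_in: "vars_in V p \<Longrightarrow> vars_in (V - {y}) (lead_in y p)"
  by (simp add: lead_in_def vars_in_coeff_in)

lemma vars_in_var_pow: "y \<in> V \<Longrightarrow> vars_in V (var_pow y n)"
  by (auto simp: vars_in_def deg_in_var_pow)

lemma vars_in_mono: "vars_in V p \<Longrightarrow> V \<subseteq> W \<Longrightarrow> vars_in W p"
  by (auto simp: vars_in_def)

text \<open>Long division in \<open>y\<close> in which \<open>f\<close> is multiplied by the leading
  coefficient of \<open>s\<close> before each step, so that \<open>c\<close> is a power of it. With
  \<open>below\<close> in place of \<open>deg_in\<close>, the remainder is 0 if \<open>s\<close> is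
  free of \<open>y\<close>.\<close>

lemma pseudo_division:
  fixes f s :: "('n::finite, 'k::idom) mvpoly"
  assumes "s \<noteq> 0" "vars_in V f" "vars_in V s" "y \<in> V"
  shows "\<exists>c q r. c \<noteq> 0 \<and> vars_in (V - {y}) c \<and> vars_in V q \<and> vars_in V r
    \<and> c * f = q * s + r \<and> below y (deg_in y s) r"
proof -
  have "\<exists>c q r. c \<noteq> 0 \<and> vars_in (V - {y}) c \<and> vars_in V q \<and> vars_in V r
    \<and> c * f = q * s + r \<and> below y (deg_in y s) r"
    if "below y n f" "vars_in V f" for n f
    using that
  proof (induction n arbitrary: f)
    case 0
    then show ?case using below_mono
      by (intro exI[of _ 1] exI[of _ 0] exI[of _ f]) (auto simp: below_0_iff)
  next
    case (Suc n)
    define k where "k = deg_in y s"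
    show ?case
    proof (cases "n < k")
      case True
      then show ?thesis using Suc.prems below_mono[of y "Suc n" f k]
        by (intro exI[of _ 1] exI[of _ 0] exI[of _ f]) (auto simp: k_def)
    next
      case False
      define cf where "cf = coeff_in y n f"
      define f' where "f' = f - cf * var_pow y n"
      define s' where "s' = s - lead_in y s * var_pow y k"
      define t where "t = cf * var_pow y (n - k)"
      have b: "below y n f'" "below y k s'"
        using Suc.prems by (auto simp: f'_def s'_def k_def cf_def below_lead_in below_coeff_in)
      have vs: "vars_in (V - {y}) (lead_in y s)" "vars_in V (lead_in y s)"
        using vars_in_lead_in[OF assms(3)] vars_in_mono by blast+
      have vcf: "vars_in V cf"
        using vars_in_coeff_in[OF Suc.prems(2)] vars_in_mono[of "V - {y}"] by (auto simp: cf_def)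
      have vt: "vars_in V t"
        unfolding t_def using assms(4) vcf by (intro vars_in_mult vars_in_var_pow)
      have "var_pow y n = (var_pow y (n - k) * var_pow y k :: ('n, 'k) mvpoly)"
        using False by (simp add: mult_single single_add[symmetric])
      then have eq: "lead_in y s * f - t * s = lead_in y s * f' - t * s'"
        by (simp add: f'_def s'_def t_def algebra_simps)
      have "below y n (lead_in y s * f' - t * s')"
      proof (rule below_diff)
        show "below y n (lead_in y s * f')" using below_mult'[of y n f' "lead_in y s" 0] b by simp
        have "deg_in y t \<le> n - k"
          using deg_in_mult_le[of y cf "var_pow y (n - k)"] by (simp add: t_def cf_def deg_in_var_pow)
        from below_mult'[OF b(2) this] show "below y n (t * s')" using False by simp
      qed
      moreover have "vars_in V (lead_in y s * f - t * s)"
        using vs vt Suc.prems assms by (intro vars_in_diff vars_in_mult)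
      ultimately obtain c q r where IH: "c \<noteq> 0" "vars_in (V - {y}) c" "vars_in V q" "vars_in V r"
          "c * (lead_in y s * f - t * s) = q * s + r" "below y (deg_in y s) r"
        using Suc.IH[of "lead_in y s * f - t * s"] unfolding eq by blast
      have "vars_in V c" using IH(2) by (rule vars_in_mono) auto
      then have "vars_in (V - {y}) (c * lead_in y s)" "vars_in V (q + c * t)"
        using IH vs vt by (auto intro!: vars_in_mult vars_in_add)
      moreover have "c * lead_in y s * f = (q + c * t) * s + r"
        using IH(5) by (simp add: algebra_simps)
      moreover have "c * lead_in y s \<noteq> 0" using IH assms by simp
      ultimately show ?thesis using IH by blast
    qed
  qed
  from this[OF below_Suc_deg_in assms(2)] show ?thesis .
qed

text \<open>As long as \<open>p\<close> divides the leading coefficient, the leading term is a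
  multiple of \<open>p\<close> and can be subtracted. This stops at a nonzero polynomial, since
  otherwise \<open>p\<close> would divide \<open>g\<close>.\<close>

lemma reduce_lead_in:
  fixes p g :: "('n::finite, 'k::idom) mvpoly"
  assumes "deg_in t p = 0" "\<not> p dvd g" "vars_in W p" "vars_in W g" "t \<in> W"
  shows "\<exists>h u. g = h + p * u \<and> \<not> p dvd lead_in t h \<and> vars_in W h"
proof (cases "p = 0")
  case True
  then show ?thesis using assms by (intro exI[of _ g] exI[of _ 0]) auto
next
  case p: False
  have "\<exists>h u. g = h + p * u \<and> \<not> p dvd lead_in t h \<and> vars_in W h"
    if "deg_in t g = n" "\<not> p dvd g" "vars_in W g" for n g
    using that
  proof (induction n arbitrary: g rule: less_induct)
    case (less n)
    show ?case
    proof (cases "p dvd lead_in t g")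
      case True
      then obtain k where k: "lead_in t g = p * k" by blast
      define h where "h = g - lead_in t g * var_pow t n"
      have kv: "vars_in W k"
        using vars_in_factor[of W p k] vars_in_lead_in[OF less.prems(3), of t] k p
          vars_in_mono[of "W - {t}" _ W] by auto
      have h: "vars_in W h"
        unfolding h_def k using kv assms less.prems
        by (intro vars_in_diff vars_in_mult vars_in_var_pow)
      have eq: "g = h + p * (k * var_pow t n)" by (simp add: h_def k mult.assoc)
      have nd: "\<not> p dvd h" using less.prems(2) eq by (metis dvd_add dvd_triv_left)
      have b: "below t n h" using below_lead_in[of t g] less.prems by (simp add: h_def)
      then have "0 < n" using nd by (cases n) (auto simp: below_0_iff)
      then have "deg_in t h < n" using b by (simp add: deg_in_less_iff_below)
      from less.IH[OF this refl nd h] obtain h' u where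
        "h = h' + p * u" "\<not> p dvd lead_in t h'" "vars_in W h'" by blast
      then show ?thesis using eq
        by (intro exI[of _ h'] exI[of _ "u + k * var_pow t n"]) (auto simp: algebra_simps)
    next
      case False
      then show ?thesis using less.prems by (intro exI[of _ g] exI[of _ 0]) auto
    qed
  qed
  then show ?thesis using assms by blast
qed

text \<open>Primality inside the subring of polynomials in the variables of \<open>V\<close>; it is inherited by
  larger \<open>V\<close>, which allows induction on the number of variables within a single type.\<close>

definition prime_in :: "'n set \<Rightarrow> ('n, 'k::idom) mvpoly \<Rightarrow> bool" where
  "prime_in V p \<longleftrightarrow> vars_in V p \<and> p \<noteq> 0 \<and> \<not> p dvd 1 \<and>
    (\<forall>g h. vars_in V g \<longrightarrow> vars_in V h \<longrightarrow> p dvd g * h \<longrightarrow> p dvd g \<or> p dvd h)"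

text \<open>Gauss's lemma: modulo \<open>p\<close>, both factors can be replaced by polynomials
  whose leading coefficients in \<open>t\<close> are not divisible by \<open>p\<close>. The product
  of these coefficients is the leading coefficient of a multiple of \<open>p\<close>, contrary to
  primality in \<open>V\<close>.\<close>

lemma prime_in_insert:
  fixes p :: "('n::finite, 'k::idom) mvpoly"
  assumes p: "prime_in V p"
  shows "prime_in (insert t V) p"
proof (cases "t \<in> V")
  case True
  then show ?thesis using p by (simp add: insert_absorb)
next
  case t: False
  have pv: "vars_in V p" "vars_in (insert t V) p" "deg_in t p = 0" "p \<noteq> 0"
    using p t by (auto simp: prime_in_def vars_in_def)
  have "p dvd g \<or> p dvd h"
    if gh: "vars_in (insert t V) g" "vars_in (insert t V) h" "p dvd g * h" for g h
  proof (rule ccontr)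
    assume "\<not> (p dvd g \<or> p dvd h)"
    then obtain g' u h' v where
      g': "g = g' + p * u" "\<not> p dvd lead_in t g'" "vars_in (insert t V) g'" and
      h': "h = h' + p * v" "\<not> p dvd lead_in t h'" "vars_in (insert t V) h'"
      using reduce_lead_in[of t p g "insert t V"] reduce_lead_in[of t p h "insert t V"] pv gh
      by auto
    have "g' * h' = g * h - p * (u * h' + v * g)"
      by (simp add: g' h' algebra_simps)
    then have "p dvd g' * h'" using gh(3) by simp
    then obtain k where "g' * h' = p * k" by blast
    then have "lead_in t g' * lead_in t h' = p * lead_in t k"
      by (metis lead_in_mult lead_in_deg_0 pv(3))
    moreover have "vars_in V (lead_in t g')" "vars_in V (lead_in t h')"
      using vars_in_lead_in[OF g'(3), of t] vars_in_lead_in[OF h'(3), of t] t by auto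
    ultimately show False using p g'(2) h'(2) unfolding prime_in_def by (metis dvd_triv_left)
  qed
  then show ?thesis using p pv(2) by (auto simp: prime_in_def)
qed

text \<open>A unit times a product of primes, in a form that lets induction strip off one prime at a
  time.\<close>

inductive factorial_in :: "'n set \<Rightarrow> ('n, 'k::idom) mvpoly \<Rightarrow> bool" for V where
  unit: "u dvd 1 \<Longrightarrow> factorial_in V u"
| mult: "prime_in V p \<Longrightarrow> factorial_in V q \<Longrightarrow> factorial_in V (p * q)"

lemma factorial_in_insert:
  fixes p :: "('n::finite, 'k::idom) mvpoly"
  shows "factorial_in V p \<Longrightarrow> factorial_in (insert t V) p"
  by (induction rule: factorial_in.induct) (auto intro: factorial_in.intros prime_in_insert)

lemma factorial_in_mult:
  fixes p q :: "('n::finite, 'k::idom) mvpoly"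
  assumes "factorial_in V p" "factorial_in V q"
  shows "factorial_in V (p * q)"
  using assms
proof (induction rule: factorial_in.induct)
  case (unit u)
  \<comment> \<open>The unit is moved past the primes of the other factor and absorbed by its
    unit.\<close>
  from unit(2,1) show ?case
  proof (induction rule: factorial_in.induct)
    case (unit w)
    then show ?case using mult_dvd_mono[of u 1 w 1] by (auto intro: factorial_in.unit)
  next
    case (mult p q)
    then show ?case using factorial_in.mult[of V p "u * q"] by (simp add: algebra_simps)
  qed
next
  case (mult a b)
  then show ?case using factorial_in.mult[of V a "b * q"] by (simp add: algebra_simps)
qed

text \<open>Each prime of \<open>c\<close> divides \<open>q\<close> or \<open>s\<close> and is
  cancelled there; \<open>q'\<close> and \<open>s'\<close> are what remains.\<close>

lemma factorial_in_cancel: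
  fixes c p q s :: "('n::finite, 'k::idom) mvpoly"
  assumes "factorial_in V c" "vars_in V q" "vars_in V s" "c * p = q * s"
  obtains q' s' where "q' dvd q" "s' dvd s" "p = q' * s'"
proof -
  have "\<exists>q' s'. q' dvd q \<and> s' dvd s \<and> p = q' * s'"
    using assms
  proof (induction arbitrary: q s rule: factorial_in.induct)
    case (unit u)
    then obtain u' where u': "1 = u * u'" by blast
    have "q = u * (u' * q)"
      by (simp flip: mult.assoc u')
    moreover have "p = u' * q * s"
    proof -
      have "p = u' * (u * p)" by (simp flip: mult.assoc u' add: mult.commute[of u'])
      then show ?thesis using unit by (simp add: mult.assoc)
    qed
    ultimately show ?case by (metis dvd_refl dvd_triv_right)
  next
    case (mult a b)
    have a: "a \<noteq> 0" using mult by (simp add: prime_in_def)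
    have "a dvd q * s" using mult.prems(3) by (metis dvd_triv_left mult.assoc)
    then have "a dvd q \<or> a dvd s" using mult by (auto simp: prime_in_def)
    then show ?case
    proof
      assume "a dvd q"
      then obtain q1 where q1: "q = a * q1" by blast
      have "a * (b * p) = a * (q1 * s)" using mult.prems(3) q1 by (simp add: mult.assoc)
      then have "b * p = q1 * s" using a by (rule mvpoly_mult_left_cancel)
      moreover have "vars_in V q1" using mult.prems(1) q1 a vars_in_factor by blast
      ultimately show ?thesis using mult.IH[of q1 s] mult.prems q1 by (metis dvd_mult)
    next
      assume "a dvd s"
      then obtain s1 where s1: "s = a * s1" by blast
      have "a * (b * p) = a * (q * s1)" using mult.prems(3) s1
        by (simp add: mult.assoc mult.left_commute)
      then have "b * p = q * s1" using a by (rule mvpoly_mult_left_cancel)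
      moreover have "vars_in V s1" using mult.prems(2) s1 a vars_in_factor by blast
      ultimately show ?thesis using mult.IH[of q s1] mult.prems s1 by (metis dvd_mult)
    qed
  qed
  then show thesis using that by blast
qed

text \<open>Take \<open>s\<close> of least degree in \<open>y\<close> among the nonzero elements of
  the ideal generated by \<open>p\<close> and \<open>g\<close>. Pseudo-remainders modulo
  \<open>s\<close> stay in the ideal and hence vanish. So \<open>s\<close> is a greatest common
  divisor once nonzero polynomials free of \<open>y\<close> are inverted.\<close>

lemma ex_pseudo_gcd:
  fixes p g :: "('n::finite, 'k::idom) mvpoly"
  assumes "p \<noteq> 0" "vars_in V p" "vars_in V g" "y \<in> V"
  obtains s u v c q c' q' where "s \<noteq> 0" "vars_in V s" "s = u * p + v * g"
    "c \<noteq> 0" "vars_in (V - {y}) c" "vars_in V q" "c * p = q * s"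
    "c' \<noteq> 0" "vars_in (V - {y}) c'" "vars_in V q'" "c' * g = q' * s"
proof -
  define I where "I = {s. \<exists>u v. vars_in V u \<and> vars_in V v \<and> s = u * p + v * g}"
  have pI: "p \<in> I" "g \<in> I"
    by (auto simp: I_def intro: exI[of _ 0] exI[of _ 1])
      (metis mult_1 mult_zero_left add_0 add_0_right vars_in_simps(2,3))+
  have "\<exists>s. (s \<in> I \<and> s \<noteq> 0) \<and> (\<forall>r. r \<in> I \<and> r \<noteq> 0 \<longrightarrow> deg_in y s \<le> deg_in y r)"
    by (rule ex_has_least_nat[of "\<lambda>s. s \<in> I \<and> s \<noteq> 0" p]) (use pI assms in auto)
  then obtain s where s: "s \<in> I" "s \<noteq> 0" "\<And>r. r \<in> I \<Longrightarrow> r \<noteq> 0 \<Longrightarrow> deg_in y s \<le> deg_in y r"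
    by blast
  have I_vars: "vars_in V r" if "r \<in> I" for r
    using that assms by (auto simp: I_def intro!: vars_in_add vars_in_mult)
  have "\<exists>c q. c \<noteq> 0 \<and> vars_in (V - {y}) c \<and> vars_in V q \<and> c * f = q * s" if f: "f \<in> I" for f
  proof -
    obtain c q r where c: "c \<noteq> 0" "vars_in (V - {y}) c" "vars_in V q" "c * f = q * s + r"
        "below y (deg_in y s) r"
      using pseudo_division[of s V f y] s I_vars f assms by blast
    obtain u v u' v' where uv: "vars_in V u" "vars_in V v" "f = u * p + v * g"
        "vars_in V u'" "vars_in V v'" "s = u' * p + v' * g"
      using f s(1) by (auto simp: I_def)
    have cV: "vars_in V c" using c(2) by (rule vars_in_mono) auto
    have "r = (c * u - q * u') * p + (c * v - q * v') * g"
      using c(4) uv by (simp add: algebra_simps)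
    moreover have "vars_in V (c * u - q * u')" "vars_in V (c * v - q * v')"
      using cV c uv by (auto intro!: vars_in_diff vars_in_mult)
    ultimately have "r \<in> I" by (auto simp: I_def)
    have "r = 0"
    proof (rule ccontr)
      assume "r \<noteq> 0"
      then have "deg_in y s > 0" using c(5) by (auto simp: below_0_iff intro: ccontr)
      then have "deg_in y r < deg_in y s" using c(5) by (simp add: deg_in_less_iff_below)
      then show False using s(3)[OF \<open>r \<in> I\<close> \<open>r \<noteq> 0\<close>] by simp
    qed
    then show ?thesis using c by auto
  qed
  from this[OF pI(1)] this[OF pI(2)] obtain c q c' q' where
    "c \<noteq> 0" "vars_in (V - {y}) c" "vars_in V q" "c * p = q * s"
    "c' \<noteq> 0" "vars_in (V - {y}) c'" "vars_in V q'" "c' * g = q' * s" by blast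
  moreover obtain u v where "s = u * p + v * g" using s(1) by (auto simp: I_def)
  ultimately show thesis using that s(2) I_vars[OF s(1)] by blast
qed

text \<open>The degrees of \<open>q'\<close> and \<open>s'\<close> have the same sum as those of
  \<open>q\<close> and \<open>s\<close>, and neither exceeds its counterpart.\<close>

lemma factor_deg_in_eq:
  fixes c p q s q' s' :: "('n::finite, 'k::idom) mvpoly"
  assumes "c * p = q * s" "c \<noteq> 0" "p \<noteq> 0" "deg_in y c = 0"
    and "q' dvd q" "s' dvd s" "p = q' * s'"
  shows "deg_in y s' = deg_in y s"
proof -
  have nz: "q \<noteq> 0" "s \<noteq> 0" "q' \<noteq> 0" "s' \<noteq> 0" using assms
    by (metis mvpoly_mult_eq_0_iff)+
  have "deg_in y q' + deg_in y s' = deg_in y p"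
    using nz by (simp add: assms(7) deg_in_mult)
  also have "\<dots> = deg_in y (c * p)"
    using assms(2-4) by (simp add: deg_in_mult)
  also have "\<dots> = deg_in y q + deg_in y s"
    using nz by (simp add: assms(1) deg_in_mult)
  finally have "deg_in y q' + deg_in y s' = deg_in y q + deg_in y s" .
  then show ?thesis using deg_in_dvd[of q' q y] deg_in_dvd[of s' s y] assms nz by simp
qed

text \<open>Induction on the variables and, within it, on the total degree. The main case is an
  irreducible \<open>p\<close> of positive degree in the new variable \<open>y\<close>; a pseudo-gcd
  of \<open>p\<close> and \<open>g\<close> shows that it is prime.\<close>

lemma factorial_in_vars_in:
  fixes p :: "('n::finite, 'k::field) mvpoly"
  assumes "p \<noteq> 0" "vars_in V p"
  shows "factorial_in V p"
proof -
  have "finite V" by simp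
  then have "\<And>p :: ('n, 'k) mvpoly. p \<noteq> 0 \<Longrightarrow> vars_in V p \<Longrightarrow> factorial_in V p"
  proof (induction V)
    case empty
    then have "p dvd 1" by (simp add: unit_iff_deg_in_0 vars_in_def)
    then show ?case by (rule factorial_in.unit)
  next
    case (insert y V)
    define W where "W = insert y V"
    have WV: "W - {y} = V" "y \<in> W" using insert by (auto simp: W_def)
    define td :: "('n, 'k) mvpoly \<Rightarrow> nat" where "td p = (\<Sum>j\<in>UNIV. deg_in j p)" for p
    have td_less: "td a < td (a * b)" if ab: "a \<noteq> 0" "b \<noteq> 0" "\<not> b dvd 1" for a b
    proof -
      obtain j where "deg_in j b \<noteq> 0" using ab by (auto simp: unit_iff_deg_in_0)
      then have "td b > 0" unfolding td_def by (metis finite sum_eq_0_iff UNIV_I gr0I)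
      then show ?thesis using ab by (simp add: td_def deg_in_mult sum.distrib)
    qed
    have "factorial_in W p" if "p \<noteq> 0" "vars_in W p" for p :: "('n, 'k) mvpoly"
      using that
    proof (induction "td p" arbitrary: p rule: less_induct)
      case less
      consider "p dvd 1" | a b where "p = a * b" "\<not> a dvd 1" "\<not> b dvd 1"
        | "irreducible p" "deg_in y p = 0" | "irreducible p" "deg_in y p > 0"
        using less.prems by (auto simp: irreducible_def)
      then show ?case
      proof cases
        case 1
        then show ?thesis by (rule factorial_in.unit)
      next
        case 2
        then have nz: "a \<noteq> 0" "b \<noteq> 0" using less.prems by auto
        have "vars_in W a" "vars_in W b"
          using vars_in_factor[of W a b] vars_in_factor[of W b a] less.prems 2 nz
          by (auto simp: mult.commute)
        moreover have "td a < td p" "td b < td p"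
          using td_less[of a b] td_less[of b a] 2 nz by (auto simp: mult.commute)
        ultimately show ?thesis using less.hyps nz 2 by (auto intro: factorial_in_mult)
      next
        case 3
        then have "vars_in V p" using less.prems by (metis WV(1) lead_in_deg_0 vars_in_lead_in)
        then show ?thesis
          using insert.IH less.prems factorial_in_insert by (auto simp: W_def)
      next
        case 4
        have fac: "factorial_in W c" if "c \<noteq> 0" "vars_in V c" for c :: "('n, 'k) mvpoly"
          using insert.IH that factorial_in_insert by (auto simp: W_def)
        have degV: "deg_in y c = 0" if "vars_in V c" for c :: "('n, 'k) mvpoly"
          using that insert.hyps by (auto simp: vars_in_def)
        \<comment> \<open>Cancelling \<open>c\<close> leaves a factor \<open>p'\<close> of
          \<open>p\<close> that divides \<open>g\<close>. It keeps the full degree in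
          \<open>y\<close>, so by irreducibility it is associated to \<open>p\<close>.\<close>
        have cancel: "p dvd g"
          if cg: "p dvd c * g" "c \<noteq> 0" "vars_in V c" "g \<noteq> 0" "vars_in W g" for c g
        proof -
          obtain k where k: "c * g = p * k" using \<open>p dvd c * g\<close> by blast
          have "vars_in W (c * g)" using that vars_in_mono[of V c W]
            by (auto intro!: vars_in_mult simp: W_def)
          then have kW: "vars_in W k" using k less.prems vars_in_factor by metis
          obtain k' p' where kp: "k' dvd k" "p' dvd p" "g = k' * p'"
            by (rule factorial_in_cancel[of W c k p g])
              (use fac cg k kW less.prems in \<open>simp_all add: mult.commute\<close>)
          have dp': "deg_in y p' = deg_in y p"
            using factor_deg_in_eq[of c g k p y k' p'] k kp that degV by (simp add: mult.commute)
          obtain t where t: "p = p' * t" using kp by blast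
          have "\<not> p' dvd 1" using dp' 4 by (auto simp: unit_iff_deg_in_0)
          then have "t dvd 1" using irreducibleD[OF 4(1) t] by simp
          then have "p dvd p'" using t by (metis dvd_def dvd_refl mult.right_neutral mult_dvd_mono)
          then show ?thesis using kp by (metis dvd_mult)
        qed
        have "p dvd g \<or> p dvd h"
          if gh: "vars_in W g" "vars_in W h" "p dvd g * h" for g h
        proof (cases "g = 0 \<or> h = 0")
          case False
          obtain s u v c q c' q' where s: "s \<noteq> 0" "vars_in W s" "s = u * p + v * g"
              "c \<noteq> 0" "vars_in (W - {y}) c" "vars_in W q" "c * p = q * s"
              "c' \<noteq> 0" "vars_in (W - {y}) c'" "vars_in W q'" "c' * g = q' * s"
            by (rule ex_pseudo_gcd[of p W g y]) (use less.prems gh WV in simp_all)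
          show ?thesis
          proof (cases "deg_in y s = 0")
            case True
            \<comment> \<open>Here \<open>p\<close> and \<open>g\<close> have no common factor
              involving \<open>y\<close>, and \<open>s\<close> can be cancelled.\<close>
            have "s * h = p * (u * h) + v * (g * h)" by (simp add: s(3) algebra_simps)
            then have "p dvd s * h" using gh(3) by simp
            moreover have "vars_in V s" using s(2) True by (metis WV(1) lead_in_deg_0 vars_in_lead_in)
            ultimately have "p dvd h" using cancel[of s h] s False gh by auto
            then show ?thesis by simp
          next
            case False': False
            obtain q1 s1 where qs: "q1 dvd q" "s1 dvd s" "p = q1 * s1"
              by (rule factorial_in_cancel[of W c q s p]) (use fac s WV in simp_all)
            have "deg_in y s1 = deg_in y s"
              using factor_deg_in_eq[of c p q s y q1 s1] s qs less.prems degV WV by auto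
            \<comment> \<open>The common factor \<open>s1\<close> is not a unit, so it exhausts the
              irreducible \<open>p\<close>, which therefore divides \<open>s\<close>.\<close>
            then have "\<not> s1 dvd 1" using False' by (auto simp: unit_iff_deg_in_0)
            then have "q1 dvd 1" using irreducibleD[OF 4(1) qs(3)] by simp
            then have "p dvd s1" using qs(3) by (metis dvd_refl mult_1 mult_dvd_mono)
            then have "p dvd c' * g" using s(11) qs(2) by (metis dvd_trans dvd_mult)
            then have "p dvd g" using cancel[of c' g] s False gh WV by auto
            then show ?thesis by simp
          qed
        qed auto
        then have "prime_in W p"
          using 4 less.prems by (auto simp: prime_in_def irreducible_def)
        from factorial_in.mult[OF this factorial_in.unit[of 1]] show ?thesis by simp
      qed
    qed
    then show ?case using insert.prems by (simp add: W_def)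
  qed
  then show ?thesis using assms by blast
qed

subsection \<open>Elimination of a variable\<close>

text \<open>If a pseudo-gcd had positive degree in \<open>y\<close>, cancelling the multipliers
  would turn it into a common factor of \<open>G\<close> and \<open>B\<close> of positive
  degree.\<close>

lemma rel_prime_imp_elimination:
  fixes G B :: "('n::finite, 'k::field) mvpoly"
  assumes "rel_prime G B" "G \<noteq> 0"
  obtains r u v where "r \<noteq> 0" "deg_in y r = 0" "r = u * G + v * B"
proof (cases "B = 0")
  case True
  then have "G dvd 1" using assms by (simp add: rel_prime_def)
  then show thesis using that[of G 1 0] assms unit_iff_deg_in_0[of G] by simp
next
  case False
  have fac: "factorial_in UNIV c" if "c \<noteq> 0" for c :: "('n, 'k) mvpoly"
    using factorial_in_vars_in[OF that, of UNIV] by simp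
  obtain s u v c q c' q' where s: "s \<noteq> 0" "s = u * G + v * B"
      "c \<noteq> 0" "vars_in (UNIV - {y}) c" "c * G = q * s"
      "c' \<noteq> 0" "vars_in (UNIV - {y}) c'" "c' * B = q' * s"
    by (rule ex_pseudo_gcd[of G UNIV B y]) (use assms in simp_all)
  have c: "deg_in y c = 0" "deg_in y c' = 0" using s by (auto simp: vars_in_def)
  have "deg_in y s = 0"
  proof (rule ccontr)
    assume ds: "deg_in y s \<noteq> 0"
    obtain q1 s1 where 1: "q1 dvd q" "s1 dvd s" "G = q1 * s1"
      using factorial_in_cancel[of UNIV c q s G] fac s by auto
    have d1: "deg_in y s1 = deg_in y s"
      using factor_deg_in_eq[of c G q s y q1 s1] s 1 assms c by auto
    obtain t where t: "s = t * s1" using 1 by (metis dvdE mult.commute)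
    \<comment> \<open>The second cancellation starts from the factor \<open>s1\<close> of
      \<open>G\<close>, so that \<open>s2\<close> divides both \<open>G\<close> and
      \<open>B\<close>.\<close>
    obtain q2 s2 where 2: "q2 dvd q' * t" "s2 dvd s1" "B = q2 * s2"
      using factorial_in_cancel[of UNIV c' "q' * t" s1 B] fac s t by (auto simp: mult.assoc)
    have "deg_in y s2 = deg_in y s1"
      using factor_deg_in_eq[of c' B "q' * t" s1 y q2 s2] s t 2 False c by (auto simp: mult.assoc)
    then have "\<not> s2 dvd 1" using ds d1 by (auto simp: unit_iff_deg_in_0)
    moreover have "s2 dvd G" "s2 dvd B" using 1 2 by auto
    ultimately show False using assms(1) by (auto simp: rel_prime_def)
  qed
  then show thesis using that s by blast
qed

text \<open>The given relation only serves to exclude a common factor; a relation of bounded degree is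
  obtained by running the Euclidean algorithm with pseudo-remainders.\<close>

lemma bounded_elimination:
  fixes x y :: "'n::finite"
  assumes "x \<noteq> y"
  shows "\<exists>K. \<forall>G B :: ('n, 'k::idom) mvpoly.
    deg_in y G + deg_in y B \<le> N \<longrightarrow> deg_in x G \<le> D \<longrightarrow> deg_in x B \<le> D \<longrightarrow>
    (\<exists>r u v. r \<noteq> 0 \<and> deg_in y r = 0 \<and> r = u * G + v * B) \<longrightarrow>
    (\<exists>r u v. r \<noteq> 0 \<and> deg_in y r = 0 \<and> r = u * G + v * B \<and>
      (\<forall>j\<in>{x, y}. deg_in j u \<le> K \<and> deg_in j v \<le> K))"
proof -
  define E :: "nat \<Rightarrow> ('n, 'k) mvpoly \<Rightarrow> ('n, 'k) mvpoly \<Rightarrow> bool" where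
    "E K G B \<longleftrightarrow> (\<exists>r u v. r \<noteq> 0 \<and> deg_in y r = 0 \<and> r = u * G + v * B \<and>
      (\<forall>j\<in>{x, y}. deg_in j u \<le> K \<and> deg_in j v \<le> K))" for K G B
  define E' :: "('n, 'k) mvpoly \<Rightarrow> ('n, 'k) mvpoly \<Rightarrow> bool" where
    "E' G B \<longleftrightarrow> (\<exists>r u v. r \<noteq> 0 \<and> deg_in y r = 0 \<and> r = u * G + v * B)" for G B
  have sym: "E K G B \<Longrightarrow> E K B G" "E' G B \<Longrightarrow> E' B G" for K G B
    unfolding E_def E'_def by (metis add.commute)+
  \<comment> \<open>A nonzero \<open>B\<close> free of \<open>y\<close> serves as \<open>r\<close>.
    If \<open>B = 0\<close>, the given relation forces \<open>G\<close> to be free of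
    \<open>y\<close>.\<close>
  have base: "E K G B" if "deg_in y B = 0" "E' G B" "deg_in y B \<le> deg_in y G" for K G B
  proof (cases "B = 0")
    case True
    then obtain r u where "r \<noteq> 0" "deg_in y r = 0" "r = u * G" using \<open>E' G B\<close> by (auto simp: E'_def)
    then have "G \<noteq> 0" "deg_in y G = 0" by (auto simp: deg_in_mult)
    then show ?thesis unfolding E_def by (intro exI[of _ G] exI[of _ 1] exI[of _ 0]) auto
  next
    case False
    then show ?thesis using that unfolding E_def
      by (intro exI[of _ B] exI[of _ 0] exI[of _ 1]) auto
  qed
  have "\<exists>K. \<forall>G B. deg_in y G + deg_in y B \<le> N \<longrightarrow> deg_in x G \<le> D \<longrightarrow> deg_in x B \<le> D \<longrightarrow>
    E' G B \<longrightarrow> deg_in y B \<le> deg_in y G \<longrightarrow> E K G B"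
  proof (induction N arbitrary: D)
    case 0
    then show ?case using base by auto
  next
    case (Suc N)
    \<comment> \<open>The pseudo-remainder \<open>l * G - t * B\<close> may have twice the degree in
      \<open>x\<close>, hence the bound \<open>D + D\<close>.\<close>
    obtain K where K: "E K G B" if "deg_in y G + deg_in y B \<le> N" "deg_in x G \<le> D + D"
        "deg_in x B \<le> D + D" "E' G B" "deg_in y B \<le> deg_in y G" for G B
      using Suc[of "D + D"] by blast
    \<comment> \<open>Substituting back multiplies \<open>u\<close> by \<open>l\<close> and
      \<open>t\<close>, whose degrees are at most \<open>D\<close> in \<open>x\<close> and at most
      \<open>Suc N\<close> in \<open>y\<close>.\<close>
    have "E (K + D + Suc N) G B"
      if GB: "deg_in y G + deg_in y B \<le> Suc N" "deg_in x G \<le> D" "deg_in x B \<le> D"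
        "E' G B" "deg_in y B \<le> deg_in y G" for G B
    proof (cases "deg_in y B = 0")
      case True
      then show ?thesis using base GB by blast
    next
      case False
      define g b where "g = deg_in y G" and "b = deg_in y B"
      have gb: "g > 0" "b > 0" "b \<le> g" and nz: "G \<noteq> 0" "B \<noteq> 0"
        using False GB by (auto simp: g_def b_def)
      define t where "t = lead_in y G * var_pow y (g - b)"
      define l where "l = lead_in y B"
      define G' where "G' = l * G - t * B"
      have l: "l \<noteq> 0" "deg_in y l = 0" "deg_in x l \<le> D"
        using nz GB deg_in_lead_in_le[of x y B] by (auto simp: l_def)
      have t: "deg_in x t \<le> D" "deg_in y t \<le> g"
        using deg_in_mult_le[of x "lead_in y G" "var_pow y (g - b)"] GB(2) deg_in_lead_in_le[of x y G]
          deg_in_mult_le[of y "lead_in y G" "var_pow y (g - b)"] assms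
        by (auto simp: t_def deg_in_var_pow)
      have "below y g G'"
      proof -
        define H C where "H = G - lead_in y G * var_pow y g" and "C = B - lead_in y B * var_pow y b"
        have HC: "below y g H" "below y b C"
          by (auto simp: H_def C_def g_def b_def below_lead_in)
        have "(var_pow y g :: ('n, 'k) mvpoly) = var_pow y (g - b) * var_pow y b"
          using gb by (simp add: mult_single single_add[symmetric])
        then have "G' = l * H - t * C"
          by (simp add: G'_def H_def C_def l_def t_def algebra_simps)
        moreover have "below y g (l * H)" using below_mult'[of y g H l 0] HC l by simp
        moreover have "deg_in y t \<le> g - b"
          using deg_in_mult_le[of y "lead_in y G" "var_pow y (g - b)"] by (simp add: t_def deg_in_var_pow)
        then have "below y g (t * C)" using below_mult'[of y b C t "g - b"] HC gb by simp
        ultimately show ?thesis by (simp add: below_diff)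
      qed
      then have dG': "deg_in y G' < g" using gb by (simp add: deg_in_less_iff_below)
      have dxG': "deg_in x G' \<le> D + D"
        unfolding G'_def using deg_in_mult_le[of x l G] deg_in_mult_le[of x t B] l t GB
        by (intro deg_in_diff) auto
      have "E' G' B"
      proof -
        obtain r u v where r: "r \<noteq> 0" "deg_in y r = 0" "r = u * G + v * B"
          using GB(4) by (auto simp: E'_def)
        have "l * r = u * G' + (u * t + v * l) * B" by (simp add: r(3) G'_def algebra_simps)
        moreover have "l * r \<noteq> 0" "deg_in y (l * r) = 0" using l r(1,2) by (auto simp: deg_in_mult)
        ultimately show ?thesis unfolding E'_def by blast
      qed
      moreover have "deg_in y G' + deg_in y B \<le> N" "deg_in x B \<le> D + D"
        using dG' GB by (auto simp: g_def)
      ultimately have "E K G' B"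
        using K[of G' B] K[of B G'] sym(1)[of K B G'] sym(2)[of G' B] dxG'
        by (cases "deg_in y B \<le> deg_in y G'") (auto simp: add.commute)
      then obtain r u v where r: "r \<noteq> 0" "deg_in y r = 0" "r = u * G' + v * B"
          and uv: "deg_in x u \<le> K" "deg_in x v \<le> K" "deg_in y u \<le> K" "deg_in y v \<le> K"
        by (auto simp: E_def)
      have "r = (u * l) * G + (v - u * t) * B" using r(3) by (simp add: G'_def algebra_simps)
      moreover have "deg_in x (u * l) \<le> K + D + Suc N" "deg_in y (u * l) \<le> K + D + Suc N"
        using deg_in_mult_le[of x u l] deg_in_mult_le[of y u l] uv l by auto
      moreover have "deg_in x (v - u * t) \<le> K + D + Suc N" "deg_in y (v - u * t) \<le> K + D + Suc N"
        using deg_in_mult_le[of x u t] deg_in_mult_le[of y u t] uv t GB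
        by (auto intro!: deg_in_diff simp: g_def)
      ultimately show ?thesis using r(1,2) unfolding E_def by blast
    qed
    then show ?case by blast
  qed
  then obtain K where K: "E K G B" if "deg_in y G + deg_in y B \<le> N" "deg_in x G \<le> D"
      "deg_in x B \<le> D" "E' G B" "deg_in y B \<le> deg_in y G" for G B
    by blast
  have "E K G B" if "deg_in y G + deg_in y B \<le> N" "deg_in x G \<le> D" "deg_in x B \<le> D" "E' G B" for G B
    using that K[of G B] K[of B G] sym by (metis add.commute nat_le_linear)
  then show ?thesis unfolding E_def E'_def by blast
qed

subsection \<open>The sparse polynomial\<close>

lemma sum_single_keys: "p = (\<Sum>m\<in>keys p. single m (lookup p m))"
  by (rule poly_mapping_eqI) (auto simp: lookup_sum lookup_single when_def in_keys_iff)

lemma var_dvd: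
  fixes p :: "('n, 'k::comm_semiring_1) mvpoly"
  assumes "\<And>m. m \<in> keys p \<Longrightarrow> lookup m y \<noteq> 0"
  shows "var_pow y 1 dvd p"
proof -
  have "var_pow y 1 dvd (\<Sum>m\<in>keys p. single m (lookup p m))"
  proof (rule dvd_sum)
    fix m assume "m \<in> keys p"
    then have "m = single y 1 + (m - single y 1)" using assms[of m]
      by (intro poly_mapping_eqI) (auto simp: lookup_add lookup_minus lookup_single when_def)
    then have "single m (lookup p m) = var_pow y 1 * single (m - single y 1) (lookup p m)"
      by (metis mult_single mult_1)
    then show "var_pow y 1 dvd single m (lookup p m)" by (metis dvd_triv_left)
  qed
  then show ?thesis using sum_single_keys[of p] by simp
qed

lemma lookup_mult_single_eq_0:
  fixes p :: "('n, 'k::comm_semiring_1) mvpoly"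
  assumes "\<And>m. m \<in> keys p \<Longrightarrow> k \<noteq> m + n"
  shows "lookup (p * single n c) k = 0"
proof (rule ccontr)
  assume "lookup (p * single n c) k \<noteq> 0"
  then have "k \<in> keys (p * single n c)" by (simp add: in_keys_iff)
  then show False using keys_mult_single[of p n c] assms by blast
qed

text \<open>\<open>G\<close> does not divide \<open>B\<close>, or it would divide \<open>A\<close>
  as well. So a multiple of \<open>G\<close> can be subtracted from \<open>B\<close> to leave
  \<open>h\<close> with leading coefficient in \<open>y\<close> not divisible by \<open>G\<close>.
  This is also the leading coefficient of \<open>A + h * M\<close>, as \<open>M\<close> is monic in
  \<open>y\<close> of higher degree than \<open>A\<close>.\<close>

lemma not_dvd_monic_of_deg_in_0:
  fixes A B G M :: "('n::finite, 'k::idom) mvpoly"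
  assumes "deg_in y G = 0" "\<not> G dvd 1" "rel_prime A B"
    and M: "lead_in y M = 1" "deg_in y A < deg_in y M"
  shows "\<not> G dvd A + B * M"
proof
  assume G: "G dvd A + B * M"
  have "\<not> G dvd B"
  proof
    assume "G dvd B"
    then have "G dvd A" using G by (metis dvd_add_left_iff dvd_mult2)
    then show False using \<open>G dvd B\<close> assms by (auto simp: rel_prime_def)
  qed
  then obtain h u where h: "B = h + G * u" "\<not> G dvd lead_in y h"
    using reduce_lead_in[of y G B UNIV] assms(1) by auto
  have "A + B * M = A + h * M + G * (u * M)" by (simp add: h algebra_simps)
  then have "G dvd A + h * M" using G by (metis dvd_add_left_iff dvd_triv_left)
  then obtain k where k: "A + h * M = G * k" by blast
  have nz: "h \<noteq> 0" "M \<noteq> 0" using h M by auto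
  define n where "n = deg_in y (h * M)"
  have n: "deg_in y A < n" using nz M by (simp add: n_def deg_in_mult)
  have hM: "lead_in y (h * M) = lead_in y h" using M by (simp add: lead_in_mult)
  define R where "R = A + (h * M - lead_in y h * var_pow y n)"
  have "below y n A" using n by (simp add: deg_in_less_iff_below[symmetric])
  then have "below y n R"
    using below_lead_in[of y "h * M"] hM by (auto simp: R_def n_def intro: below_add)
  moreover have "A + h * M = lead_in y h * var_pow y n + R" by (simp add: R_def)
  ultimately have "lead_in y (A + h * M) = lead_in y h"
    using nz by (simp add: lead_in_top)
  then have "lead_in y h = G * lead_in y k"
    using k assms(1) by (simp add: lead_in_mult lead_in_deg_0)
  then show False using h(2) by simp
qed

section \<open>Monomials and factors of \<open>A + B * M\<close>\<close>

context
  fixes x y :: "'n::finite" and \<tau> :: "'n \<Rightarrow>\<^sub>0 nat" and c d e q :: nat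
    and M :: "('n, 'k::idom) mvpoly"
  assumes xy: "x \<noteq> y"
    and \<tau>: "lookup \<tau> x = e" "lookup \<tau> y = 0"
    and cd: "c + d = e + 1 + q" "d \<le> e" "2 * q < d"
    and M_def: "M = var_pow y d + single (\<tau> + single y (d - 1)) 1 + var_pow x c"
begin

text \<open>A monomial comes from \<open>A\<close> or from one of the three terms of
  \<open>M\<close>. Only the exponents of \<open>x\<close> and \<open>y\<close> are recorded,
  because all weights below depend on these alone.\<close>

lemma keys_add_mult_M:
  assumes "k \<in> keys (A + B * M)"
    "deg_in x A \<le> \<alpha>" "deg_in y A \<le> \<alpha>"
  obtains "lookup k x \<le> \<alpha>" "lookup k y \<le> \<alpha>"
  | m where "m \<in> keys B" "lookup k x = lookup m x" "lookup k y = lookup m y + d"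
  | m where "m \<in> keys B" "lookup k x = lookup m x + e" "lookup k y + 1 = lookup m y + d"
  | m where "m \<in> keys B" "lookup k x = lookup m x + c" "lookup k y = lookup m y"
proof -
  have "A + B * M = A + (B * var_pow y d + (B * single (\<tau> + single y (d - 1)) 1 + B * var_pow x c))"
    by (simp add: M_def algebra_simps)
  then consider "k \<in> keys A" | "k \<in> keys (B * var_pow y d)"
    | "k \<in> keys (B * single (\<tau> + single y (d - 1)) 1)" | "k \<in> keys (B * var_pow x c)"
    using assms(1) keys_add[of A "B * var_pow y d + (B * single (\<tau> + single y (d - 1)) 1 + B * var_pow x c)"]
      keys_add[of "B * var_pow y d" "B * single (\<tau> + single y (d - 1)) 1 + B * var_pow x c"]
      keys_add[of "B * single (\<tau> + single y (d - 1)) 1" "B * var_pow x c"]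
    by auto
  then show thesis
  proof cases
    case 1
    then show ?thesis using that(1) assms(2,3) le_deg_in[OF 1] le_trans by blast
  next
    case 2
    then obtain m where "m \<in> keys B" "k = m + single y d"
      using keys_mult_single by blast
    then show ?thesis using that(2)[of m] xy by (simp add: lookup_add lookup_single)
  next
    case 3
    then obtain m where "m \<in> keys B" "k = m + (\<tau> + single y (d - 1))"
      using keys_mult_single by blast
    then show ?thesis using that(3)[of m] xy \<tau> cd by (simp add: lookup_add lookup_single)
  next
    case 4
    then obtain m where "m \<in> keys B" "k = m + single x c"
      using keys_mult_single by blast
    then show ?thesis using that(4)[of m] xy by (simp add: lookup_add lookup_single)
  qed
qed

context
  fixes A B :: "('n, 'k) mvpoly" and \<alpha> :: nat
  assumes A: "deg_in x A \<le> \<alpha>" "deg_in y A \<le> \<alpha>"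
    and B: "deg_in x B \<le> \<alpha>" "deg_in y B \<le> \<alpha>"
    and \<alpha>: "\<alpha> < q"
begin

lemma lookup_add_mult_M:
  "lookup (A + B * M) k = lookup A k + (lookup (B * var_pow y d) k
    + (lookup (B * single (\<tau> + single y (d - 1)) 1) k + lookup (B * var_pow x c) k))"
  by (simp add: M_def distrib_left lookup_add add.assoc)

lemma B_le: "m \<in> keys B \<Longrightarrow> lookup m x \<le> \<alpha>" "m \<in> keys B \<Longrightarrow> lookup m y \<le> \<alpha>"
  using le_deg_in[of m B] B le_trans by blast+

lemma A_not_key: "lookup k x > \<alpha> \<or> lookup k y > \<alpha> \<Longrightarrow> lookup A k = 0"
  using le_deg_in[of k A] A by (metis in_keys_iff le_trans not_le)

text \<open>Nothing cancels: exponents of \<open>x\<close> and \<open>y\<close> in \<open>A\<close>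
  and \<open>B\<close> are at most \<alpha>, and the terms of \<open>M\<close> differ from each
  other by more than that in one of the two. The same holds for \<open>key_y\<close> and
  \<open>key_x\<close>.\<close>

lemma key_xy:
  assumes m: "m \<in> keys B"
  shows "m + (\<tau> + single y (d - 1)) \<in> keys (A + B * M)"
proof -
  let ?k = "m + (\<tau> + single y (d - 1))"
  have k: "lookup ?k x = lookup m x + e" "lookup ?k y = lookup m y + (d - 1)"
    using xy \<tau> by (simp_all add: lookup_add lookup_single)
  have "lookup (B * var_pow y d) ?k = 0"
  proof (rule lookup_mult_single_eq_0)
    fix n assume n: "n \<in> keys B"
    have "lookup (n + single y d) x \<le> \<alpha>" using B_le[OF n] xy by (simp add: lookup_add lookup_single)
    moreover have "lookup ?k x > \<alpha>" using k \<alpha> cd by simp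
    ultimately show "?k \<noteq> n + single y d" by (metis not_le)
  qed
  moreover have "lookup (B * var_pow x c) ?k = 0"
  proof (rule lookup_mult_single_eq_0)
    fix n assume n: "n \<in> keys B"
    have "lookup (n + single x c) y \<le> \<alpha>" using B_le[OF n] xy by (simp add: lookup_add lookup_single)
    moreover have "lookup ?k y > \<alpha>" using k \<alpha> cd by simp
    ultimately show "?k \<noteq> n + single x c" by (metis not_le)
  qed
  moreover have "lookup A ?k = 0" using A_not_key[of ?k] k \<alpha> cd by simp
  moreover have "lookup (B * single (\<tau> + single y (d - 1)) 1) ?k = lookup B m" by simp
  ultimately show ?thesis using m by (simp only: in_keys_iff lookup_add_mult_M) simp
qed

lemma key_y:
  assumes m: "m \<in> keys B"
  shows "m + single y d \<in> keys (A + B * M)"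
proof -
  let ?k = "m + single y d"
  have k: "lookup ?k x = lookup m x" "lookup ?k y = lookup m y + d"
    using xy by (simp_all add: lookup_add lookup_single)
  have "lookup (B * single (\<tau> + single y (d - 1)) 1) ?k = 0"
  proof (rule lookup_mult_single_eq_0)
    fix n assume n: "n \<in> keys B"
    have "lookup (n + (\<tau> + single y (d - 1))) x > \<alpha>" using xy \<tau> \<alpha> cd
      by (simp add: lookup_add lookup_single)
    then show "?k \<noteq> n + (\<tau> + single y (d - 1))" using k B_le[OF m] by (metis not_le)
  qed
  moreover have "lookup (B * var_pow x c) ?k = 0"
  proof (rule lookup_mult_single_eq_0)
    fix n assume n: "n \<in> keys B"
    have "lookup (n + single x c) y \<le> \<alpha>" using B_le[OF n] xy by (simp add: lookup_add lookup_single)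
    moreover have "lookup ?k y > \<alpha>" using k \<alpha> cd by simp
    ultimately show "?k \<noteq> n + single x c" by (metis not_le)
  qed
  moreover have "lookup A ?k = 0" using A_not_key[of ?k] k \<alpha> cd by simp
  moreover have "lookup (B * var_pow y d) ?k = lookup B m" by simp
  ultimately show ?thesis using m by (simp only: in_keys_iff lookup_add_mult_M) simp
qed

lemma key_x:
  assumes m: "m \<in> keys B"
  shows "m + single x c \<in> keys (A + B * M)"
proof -
  let ?k = "m + single x c"
  have k: "lookup ?k x = lookup m x + c" "lookup ?k y = lookup m y"
    using xy by (simp_all add: lookup_add lookup_single)
  have "lookup (B * single (\<tau> + single y (d - 1)) 1) ?k = 0"
  proof (rule lookup_mult_single_eq_0)
    fix n assume n: "n \<in> keys B"
    have "lookup (n + (\<tau> + single y (d - 1))) y > \<alpha>" using xy \<tau> \<alpha> cd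
      by (simp add: lookup_add lookup_single)
    then show "?k \<noteq> n + (\<tau> + single y (d - 1))" using k B_le[OF m] by (metis not_le)
  qed
  moreover have "lookup (B * var_pow y d) ?k = 0"
  proof (rule lookup_mult_single_eq_0)
    fix n assume n: "n \<in> keys B"
    have "lookup (n + single y d) y > \<alpha>" using xy \<alpha> cd
      by (simp add: lookup_add lookup_single)
    then show "?k \<noteq> n + single y d" using k B_le[OF m] by (metis not_le)
  qed
  moreover have "lookup A ?k = 0" using A_not_key[of ?k] k \<alpha> cd by simp
  moreover have "lookup (B * var_pow x c) ?k = lookup B m" by simp
  ultimately show ?thesis using m by (simp only: in_keys_iff lookup_add_mult_M) simp
qed

text \<open>If every monomial of \<open>B\<close> contains \<open>y\<close>, then \<open>y\<close>
  does not divide \<open>A\<close>, and a \<open>y\<close>-free monomial of \<open>A\<close>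
  survives. Otherwise \<open>x ^ c\<close> times a \<open>y\<close>-free monomial of
  \<open>B\<close> does.\<close>

lemma ex_key_y_free:
  assumes "rel_prime A B"
  obtains k where "k \<in> keys (A + B * M)" "lookup k y = 0"
proof (cases "\<exists>m\<in>keys B. lookup m y = 0")
  case True
  then obtain m where "m \<in> keys B" "lookup m y = 0" by blast
  then show thesis using that[of "m + single x c"] key_x[of m] xy
    by (simp add: lookup_add lookup_single)
next
  case False
  have "\<not> (var_pow y 1 :: ('n, 'k) mvpoly) dvd 1"
    using deg_in_dvd[of "var_pow y 1" "1 :: ('n, 'k) mvpoly" y] by (auto simp: deg_in_var_pow)
  then have "\<not> var_pow y 1 dvd A" using False var_dvd[of B y] assms by (auto simp: rel_prime_def)
  then obtain k where k: "k \<in> keys A" "lookup k y = 0" using var_dvd[of A y] by blast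
  have ky: "lookup k y < d - 1" using k \<alpha> cd by simp
  have "lookup (B * var_pow y d) k = 0" "lookup (B * single (\<tau> + single y (d - 1)) 1) k = 0"
    using ky by (auto intro!: lookup_mult_single_eq_0 simp: lookup_add)
  moreover have "lookup (B * var_pow x c) k = 0"
    using k(2) False by (intro lookup_mult_single_eq_0) (auto simp: lookup_add)
  ultimately have "k \<in> keys (A + B * M)"
    using k by (simp only: in_keys_iff lookup_add_mult_M) simp
  then show thesis using that k by blast
qed

text \<open>\<open>G\<close> is the factor without the large root: the monomial \<open>m + \<tau> + (d - 1) y\<close> splits so that
  \<open>F\<close> contributes its second highest power of \<open>y\<close>.  The weight \<open>x + (e + q) y\<close> shows that
  \<open>m1\<close> carries all of \<open>x ^ e\<close>; then the weight \<open>x\<close> bounds the degree of \<open>G\<close> in \<open>x\<close> and the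
  weight \<open>2 x - y\<close> its degree in \<open>y\<close>.\<close>

lemma factor_deg_in_bounds_aux:
  assumes FG: "A + B * M = F * G" and y_free: "m0 \<in> keys G" "lookup m0 y = 0"
    and m: "m \<in> keys B" and b: "deg_in y B = lookup m y"
    and W_max: "\<And>k. k \<in> keys B \<Longrightarrow>
      int (lookup k x) + int (e + q) * int (lookup k y)
      \<le> int (lookup m x) + int (e + q) * int (lookup m y)"
    and split: "m + (\<tau> + single y (d - 1)) = m1 + m2" "m1 \<in> keys F" "m2 \<in> keys G"
    and top: "lookup m2 y = deg_in y G"
    and deg: "deg_in y F + deg_in y G = deg_in y B + d"
  shows "deg_in x G \<le> \<alpha> \<and> deg_in y G \<le> 3 * \<alpha>"
proof -
  \<comment> \<open>\<open>N\<close> is at least \<open>e\<close>, \<open>c\<close> and \<alpha>, so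
    that \<open>y ^ d\<close> has the largest weight among the terms of \<open>M\<close>.\<close>
  define N where "N = int (e + q)"
  define \<gamma> b where "\<gamma> = int (lookup m x)" and "b = int (lookup m y)"
  have s: "int (lookup m1 x) + int (lookup m2 x) = \<gamma> + int e"
    "int (lookup m1 y) + int (lookup m2 y) = b + int d - 1"
    using arg_cong[OF split(1), of "\<lambda>k. lookup k x"] arg_cong[OF split(1), of "\<lambda>k. lookup k y"]
      xy \<tau> cd by (auto simp: lookup_add lookup_single \<gamma>_def b_def)
  have "F \<noteq> 0" using split by auto
  then obtain n where n: "n \<in> keys F" "lookup n y = deg_in y F" by (rule deg_in_attained)
  have "(int (lookup n x) + N * int (lookup n y)) + (int (lookup m2 x) + N * int (lookup m2 y))
      \<le> \<gamma> + N * b + N * int d"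
  proof (rule keys_mult_bound[of "\<lambda>k. int (lookup k x) + N * int (lookup k y)", OF _ n(1) split(3)])
    fix k assume "k \<in> keys (F * G)"
    then have key: "k \<in> keys (A + B * M)" by (simp add: FG)
    show "int (lookup k x) + N * int (lookup k y) \<le> \<gamma> + N * b + N * int d"
    proof (cases rule: keys_add_mult_M[OF key A])
      case 1
      have "N * int (lookup k y) \<le> N * (int d - 1)" using 1 \<alpha> cd
        by (intro mult_left_mono) (auto simp: N_def)
      moreover have "int (lookup k x) \<le> N" using 1 \<alpha> by (simp add: N_def)
      moreover have "0 \<le> N * b" "0 \<le> \<gamma>" by (auto simp: N_def b_def \<gamma>_def)
      ultimately show ?thesis by (simp add: right_diff_distrib)
    next
      case (2 k')
      then show ?thesis using W_max[of k'] by (simp add: N_def \<gamma>_def b_def algebra_simps)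
    next
      case (3 k')
      then have "int (lookup k y) = int (lookup k' y) + int d - 1" by simp
      then have "N * int (lookup k y) = N * int (lookup k' y) + N * int d - N"
        by (simp only:) (simp add: algebra_simps)
      moreover have "int e \<le> N" by (simp add: N_def)
      ultimately show ?thesis using W_max[of k'] 3 by (simp add: N_def \<gamma>_def b_def)
    next
      case (4 k')
      have "N * 1 \<le> N * int d" using cd by (intro mult_left_mono) (auto simp: N_def)
      moreover have "int c \<le> N" using cd by (simp add: N_def)
      ultimately show ?thesis using W_max[of k'] 4 by (simp add: N_def \<gamma>_def b_def)
    qed
  qed (simp_all add: lookup_add algebra_simps)
  moreover have "N * int (lookup n y) + N * int (lookup m2 y) = N * b + N * int d"
  proof -
    have "int (lookup n y) + int (lookup m2 y) = b + int d"
      using deg n top b by (simp add: b_def)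
    then show ?thesis by (metis distrib_left)
  qed
  \<comment> \<open>\<open>n\<close> and \<open>m2\<close> both have full degree in
    \<open>y\<close>, so the weight bound reduces to one for their exponents of
    \<open>x\<close>.\<close>
  ultimately have "int (lookup m2 x) \<le> \<gamma>" by simp
  then have m1x: "lookup m1 x \<ge> e" using s(1) by simp
  have "lookup k x \<le> \<alpha>" if "k \<in> keys G" for k
  proof -
    have "int (lookup m1 x) + int (lookup k x) \<le> int (\<alpha> + e)"
    proof (rule keys_mult_bound[of "\<lambda>k. int (lookup k x)", OF _ split(2) that])
      fix l assume "l \<in> keys (F * G)"
      then have key: "l \<in> keys (A + B * M)" by (simp add: FG)
      have "lookup l x \<le> \<alpha> + e"
        by (cases rule: keys_add_mult_M[OF key A]) (use B_le cd in force)+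
      then show "int (lookup l x) \<le> int (\<alpha> + e)" by simp
    qed (simp add: lookup_add)
    then show ?thesis using m1x by simp
  qed
  then have "deg_in x G \<le> \<alpha>" by (auto simp: deg_in_le_iff)
  moreover have "deg_in y G \<le> 3 * \<alpha>"
  proof -
    \<comment> \<open>For the weight \<open>2 x - y\<close>, the term \<open>x ^ c\<close> stays
      within the bound because \<open>2 * q < d\<close>.\<close>
    have "(2 * int (lookup m1 x) - int (lookup m1 y)) + (2 * int (lookup m0 x) - int (lookup m0 y))
      \<le> 2 * int \<alpha> + 2 * int e - (int d - 1)"
    proof (rule keys_mult_bound[of "\<lambda>k. 2 * int (lookup k x) - int (lookup k y)",
          OF _ split(2) y_free(1)])
      fix l assume "l \<in> keys (F * G)"
      then have key: "l \<in> keys (A + B * M)" by (simp add: FG)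
      show "2 * int (lookup l x) - int (lookup l y) \<le> 2 * int \<alpha> + 2 * int e - (int d - 1)"
      proof (cases rule: keys_add_mult_M[OF key A])
        case 1
        then show ?thesis using cd by simp
      next
        case (2 k)
        then show ?thesis using B_le[of k] cd by simp
      next
        case (3 k)
        then show ?thesis using B_le[of k] cd by simp
      next
        case (4 k)
        then show ?thesis using B_le[of k] cd by simp
      qed
    qed (simp add: lookup_add)
    \<comment> \<open>As \<open>m0\<close> is free of \<open>y\<close>, its weight is not negative;
      so \<open>m1\<close> takes all but at most \<open>2 * \<alpha>\<close> of the
      \<open>d - 1\<close> powers of \<open>y\<close>.\<close>
    then have "int d \<le> 2 * int \<alpha> + int (lookup m1 y) + 1" using m1x y_free(2) by simp
    then show ?thesis using s(2) top b B(2) by (simp add: b_def)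
  qed
  ultimately show ?thesis ..
qed

text \<open>The monomial \<open>m + \<tau> + (d - 1) y\<close> lies one below the degree of the
  product in \<open>y\<close>. In its splitting exactly one part attains the degree of its factor,
  and that factor is the bounded one.\<close>

lemma factor_deg_in_bounds:
  assumes FG: "A + B * M = F * G" and "B \<noteq> 0" "rel_prime A B"
  shows "deg_in x F \<le> \<alpha> \<and> deg_in y F \<le> 3 * \<alpha> \<or> deg_in x G \<le> \<alpha> \<and> deg_in y G \<le> 3 * \<alpha>"
proof -
  obtain k0 where k0: "k0 \<in> keys (F * G)" "lookup k0 y = 0"
    using ex_key_y_free[OF assms(3)] unfolding FG by blast
  obtain f0 g0 where "f0 \<in> keys F" "g0 \<in> keys G" "k0 = f0 + g0"
    by (rule keys_mult_split[OF k0(1)])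
  then have fg0: "f0 \<in> keys F" "g0 \<in> keys G" "lookup f0 y = 0" "lookup g0 y = 0"
    using k0(2) by (auto simp: lookup_add)
  obtain m where m: "m \<in> keys B" and W_max: "\<And>k. k \<in> keys B \<Longrightarrow>
      int (lookup k x) + int (e + q) * int (lookup k y)
      \<le> int (lookup m x) + int (e + q) * int (lookup m y)"
  proof -
    define W where "W k = int (lookup k x) + int (e + q) * int (lookup k y)" for k
    have "keys B \<noteq> {}" using assms(2) by simp
    then have "Max (W ` keys B) \<in> W ` keys B" by (intro Max_in) auto
    then obtain m where "m \<in> keys B" "W m = Max (W ` keys B)" by auto
    then show thesis using that[of m] by (simp add: W_def)
  qed
  \<comment> \<open>One more power of \<open>y\<close> adds \<open>e + q\<close> to the weight, more
    than any exponent of \<open>x\<close> in \<open>B\<close> can make up for.\<close>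
  have b: "deg_in y B = lookup m y"
  proof (rule antisym)
    show "deg_in y B \<le> lookup m y"
      unfolding deg_in_le_iff
    proof (intro ballI leI notI)
      fix k assume k: "k \<in> keys B" "lookup m y < lookup k y"
      have "int (e + q) * (int (lookup m y) + 1) \<le> int (e + q) * int (lookup k y)"
        using k(2) by (intro mult_left_mono) auto
      then show False using W_max[OF k(1)] B_le[OF m] \<alpha> cd by (simp add: algebra_simps)
    qed
  qed (rule le_deg_in[OF m])
  have nz: "F \<noteq> 0" "G \<noteq> 0" using fg0 by auto
  have dP: "deg_in y F + deg_in y G = deg_in y B + d"
  proof -
    have "deg_in y (A + B * M) = deg_in y B + d"
    proof (rule antisym)
      show "deg_in y (A + B * M) \<le> deg_in y B + d"
        unfolding deg_in_le_iff
      proof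
        fix k assume key: "k \<in> keys (A + B * M)"
        show "lookup k y \<le> deg_in y B + d"
          by (cases rule: keys_add_mult_M[OF key A]) (use le_deg_in[of _ B y] \<alpha> cd in force)+
      qed
      show "deg_in y B + d \<le> deg_in y (A + B * M)"
        using le_deg_in[OF key_y[OF m], of y] b by (simp add: lookup_add)
    qed
    then show ?thesis using nz by (simp add: FG deg_in_mult)
  qed
  obtain m1 m2 where s: "m + (\<tau> + single y (d - 1)) = m1 + m2" "m1 \<in> keys F" "m2 \<in> keys G"
    by (rule keys_mult_split[OF key_xy[OF m, unfolded FG]])
  have "lookup m y + (d - 1) = lookup m1 y + lookup m2 y"
    using arg_cong[OF s(1), of "\<lambda>k. lookup k y"] \<tau> by (simp add: lookup_add)
  moreover have "lookup m1 y \<le> deg_in y F" "lookup m2 y \<le> deg_in y G"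
    using s le_deg_in by auto
  ultimately consider "lookup m2 y = deg_in y G" | "lookup m1 y = deg_in y F"
    using dP b cd by linarith
  then show ?thesis
  proof cases
    case 1
    then show ?thesis using factor_deg_in_bounds_aux[OF FG fg0(2,4) m b W_max s _ dP] by blast
  next
    case 2
    then show ?thesis
      using factor_deg_in_bounds_aux[of G F f0 m m2 m1] FG fg0 m b W_max s dP
      by (simp add: mult.commute add.commute)
  qed
qed

text \<open>The weight \<open>x + q y\<close> shows that the monomial \<open>i\<close> of \<open>G\<close> is of maximal degree in \<open>y\<close>, and \<open>W\<close>
  is the weight for which \<open>x ^ e y ^ (d - 1)\<close> and \<open>x ^ c\<close> are of equal weight.\<close>

lemma no_small_factor:
  assumes GH: "A + B * M = G * H" and "B \<noteq> 0" "deg_in y B = 0"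
    and G: "deg_in x G < q" "0 < deg_in y G" "deg_in y G * q < d - 1"
  shows False
proof -
  define g where "g = deg_in y G"
  obtain m where m: "m \<in> keys B" "lookup m x = deg_in x B" using assms(2) by (rule deg_in_attained)
  define \<rho> where "\<rho> = int (lookup m x)"
  have keys_B: "lookup k y = 0" "int (lookup k x) \<le> \<rho>" if "k \<in> keys B" for k
    using le_deg_in[OF that] assms(3) m(2) by (auto simp: \<rho>_def) (metis le_zero_eq)
  obtain i j where ij: "m + (\<tau> + single y (d - 1)) = i + j" "i \<in> keys G" "j \<in> keys H"
    by (rule keys_mult_split[OF key_xy[OF m(1), unfolded GH]])
  obtain i0 j0 where ij0: "m + single x c = i0 + j0" "i0 \<in> keys G" "j0 \<in> keys H"
    by (rule keys_mult_split[OF key_x[OF m(1), unfolded GH]])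
  have ij_xy: "int (lookup i x) + int (lookup j x) = \<rho> + int e"
    "int (lookup i y) + int (lookup j y) = int d - 1"
    using arg_cong[OF ij(1), of "\<lambda>k. lookup k x"] arg_cong[OF ij(1), of "\<lambda>k. lookup k y"]
      xy \<tau> cd keys_B[OF m(1)] by (auto simp: lookup_add lookup_single \<rho>_def)
  have ij0_xy: "int (lookup i0 x) + int (lookup j0 x) = \<rho> + int c" "lookup i0 y = 0" "lookup j0 y = 0"
    using arg_cong[OF ij0(1), of "\<lambda>k. lookup k x"] arg_cong[OF ij0(1), of "\<lambda>k. lookup k y"]
      xy keys_B[OF m(1)] by (auto simp: lookup_add lookup_single \<rho>_def)
  have \<rho>: "0 \<le> \<rho>" by (simp add: \<rho>_def)
  have iy: "lookup i y = g"
  proof -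
    have "G \<noteq> 0" using ij by auto
    then obtain n where n: "n \<in> keys G" "lookup n y = g" unfolding g_def by (rule deg_in_attained)
    define N where "N = int q"
    have "(int (lookup n x) + N * int (lookup n y)) + (int (lookup j x) + N * int (lookup j y))
      \<le> \<rho> + int e + N * (int d - 1)"
    proof (rule keys_mult_bound[of "\<lambda>k. int (lookup k x) + N * int (lookup k y)", OF _ n(1) ij(3)])
      fix k assume "k \<in> keys (G * H)"
      then have key: "k \<in> keys (A + B * M)" by (simp add: GH)
      show "int (lookup k x) + N * int (lookup k y) \<le> \<rho> + int e + N * (int d - 1)"
      proof (cases rule: keys_add_mult_M[OF key A])
        case 1
        have "N * int (lookup k y) \<le> N * (int d - 1)" using 1 \<alpha> cd
          by (intro mult_left_mono) (auto simp: N_def)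
        then show ?thesis using 1 \<alpha> cd \<rho> by simp
      next
        case (2 k')
        then have "lookup k y = d" "int (lookup k x) \<le> \<rho>" using keys_B[of k'] by auto
        then show ?thesis using cd by (simp add: N_def algebra_simps)
      next
        case (3 k')
        then have "int (lookup k y) = int d - 1" "int (lookup k x) \<le> \<rho> + int e"
          using keys_B[of k'] by auto
        then show ?thesis by simp
      next
        case (4 k')
        then have "lookup k y = 0" "int (lookup k x) \<le> \<rho> + int c" using keys_B[of k'] by auto
        moreover have "0 \<le> N * (int d - 1)" using cd by (simp add: N_def)
        ultimately show ?thesis using cd by simp
      qed
    qed (simp_all add: lookup_add algebra_simps)
    moreover have "N * (int d - 1) = N * int (lookup i y) + N * int (lookup j y)"
      by (metis ij_xy(2) distrib_left)
    ultimately have "N * int g \<le> int (lookup i x) + N * int (lookup i y)"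
      using ij_xy(1) n(2) by simp
    \<comment> \<open>An exponent of \<open>x\<close> less than \<open>q\<close> cannot compensate
      for a missing power of \<open>y\<close>.\<close>
    moreover have "int (lookup i x) < N" using le_deg_in[OF ij(2), of x] G(1) by (simp add: N_def)
    ultimately have "N * int g < N * (int (lookup i y) + 1)" by (simp add: algebra_simps)
    then have "int g < int (lookup i y) + 1" using \<alpha> by (simp add: N_def)
    then show ?thesis using le_deg_in[OF ij(2), of y] by (simp add: g_def)
  qed
  define D where "D = int d - 1"
  define W where "W k = D * int (lookup k x) - (D - int q) * int (lookup k y)" for k :: "'n \<Rightarrow>\<^sub>0 nat"
  have W_add: "W (a + b) = W a + W b" for a b by (simp add: W_def lookup_add algebra_simps)
  have D: "D > 0" "D \<ge> int q" "int c = int e - D + int q" using cd \<alpha> by (auto simp: D_def)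
  have W_le: "W k \<le> D * (\<rho> + int c)" if "k \<in> keys (G * H)" for k
  proof -
    have pos: "0 \<le> (D - int q) * int (lookup k y)" using D by simp
    have key: "k \<in> keys (A + B * M)" using that by (simp add: GH)
    show ?thesis
    proof (cases rule: keys_add_mult_M[OF key A])
      case 1
      have "D * int (lookup k x) \<le> D * (\<rho> + int c)" using 1 \<alpha> cd \<rho> D by (intro mult_left_mono) auto
      then show ?thesis using pos by (simp add: W_def)
    next
      case (2 k')
      then have "D * int (lookup k x) \<le> D * (\<rho> + int c)" using keys_B[of k'] D by (intro mult_left_mono) auto
      then show ?thesis using pos by (simp add: W_def)
    next
      case (3 k')
      then have *: "int (lookup k y) = D" "int (lookup k x) \<le> \<rho> + int e"
        using keys_B[of k'] by (auto simp: D_def)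
      have "W k = D * (int (lookup k x) - D + int q)" using * by (simp add: W_def algebra_simps)
      also have "\<dots> \<le> D * (\<rho> + int c)" using * D by (intro mult_left_mono) auto
      finally show ?thesis .
    next
      case (4 k')
      then have "D * int (lookup k x) \<le> D * (\<rho> + int c)" using keys_B[of k'] D by (intro mult_left_mono) auto
      then show ?thesis using pos by (simp add: W_def)
    qed
  qed
  have "W i + W j = D * (\<rho> + int c)"
  proof -
    have "W i + W j = D * (int (lookup i x) + int (lookup j x))
        - (D - int q) * (int (lookup i y) + int (lookup j y))"
      by (simp add: W_def algebra_simps)
    also have "\<dots> = D * (\<rho> + int e) - (D - int q) * D" using ij_xy by (simp add: D_def)
    also have "\<dots> = D * (\<rho> + int c)" unfolding D(3) by (simp add: algebra_simps)
    finally show ?thesis .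
  qed
  moreover have "W i0 + W j0 = D * (\<rho> + int c)"
    using ij0_xy by (simp add: W_def distrib_left[symmetric])
  \<comment> \<open>The two mixed sums add up to twice the maximum, so both attain it.\<close>
  moreover have "W i + W j0 \<le> D * (\<rho> + int c)" "W i0 + W j \<le> D * (\<rho> + int c)"
    by (rule keys_mult_bound[of W, OF W_add _ _ W_le]; use ij ij0 in simp)+
  ultimately have "W i = W i0" by linarith
  \<comment> \<open>Comparing the equal weights of \<open>i\<close> and \<open>i0\<close> shows that
    \<open>D\<close> divides the smaller positive number \<open>q * g\<close>.\<close>
  then have "int q * int g = D * (int g + int (lookup i0 x) - int (lookup i x))"
    using iy ij0_xy by (simp add: W_def algebra_simps)
  then have "D dvd int q * int g" by simp
  moreover have "int q * int g > 0" using G(2) \<alpha> by (simp add: g_def)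
  moreover have "int q * int g < D"
  proof -
    have "int (g * q) < int (d - 1)" using G(3) unfolding g_def by linarith
    then show ?thesis using cd by (simp add: D_def mult.commute)
  qed
  ultimately show False using zdvd_imp_le by fastforce
qed

end

lemma
  shows lead_in_M: "lead_in y M = 1" and deg_in_M: "deg_in y M = d"
proof -
  have M': "M = 1 * var_pow y d + (single (\<tau> + single y (d - 1)) 1 + var_pow x c)"
    by (simp add: M_def add.assoc)
  have b: "below y d (single (\<tau> + single y (d - 1)) 1 + var_pow x c :: ('n, 'k) mvpoly)"
    using xy \<tau> cd by (intro below_add) (auto simp: below_def lookup_add lookup_single)
  show "lead_in y M = 1" "deg_in y M = d"
    unfolding M' by (rule lead_in_top deg_in_top; use b in simp)+
qed

end

text \<open>The bound \<open>K\<close> holds for all \<open>G\<close> and \<open>B\<close> at once,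
  so \<open>q\<close> can be fixed before any factor is known. In \<open>4 * \<alpha>\<close>, a
  share of \<open>3 * \<alpha>\<close> is for the small factor and \<alpha> for
  \<open>B\<close>.\<close>

lemma irreducible_add_mult_sparse:
  fixes x y :: "'n::finite" and A B M :: "('n, 'k::field) mvpoly"
  assumes xy: "x \<noteq> y"
    and \<tau>: "lookup \<tau> x = e" "lookup \<tau> y = 0"
    and cd: "c + d = e + 1 + q" "d \<le> e" "2 * q < d" "3 * \<alpha> * q < d - 1"
    and M_def: "M = var_pow y d + single (\<tau> + single y (d - 1)) 1 + var_pow x c"
    and A: "deg_in x A \<le> \<alpha>" "deg_in y A \<le> \<alpha>"
    and B: "deg_in x B \<le> \<alpha>" "deg_in y B \<le> \<alpha>" "B \<noteq> 0" "rel_prime A B"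
    and K: "\<And>G B :: ('n, 'k) mvpoly.
      deg_in y G + deg_in y B \<le> 4 * \<alpha> \<Longrightarrow> deg_in x G \<le> \<alpha> \<Longrightarrow> deg_in x B \<le> \<alpha> \<Longrightarrow>
      (\<exists>r u v. r \<noteq> 0 \<and> deg_in y r = 0 \<and> r = u * G + v * B) \<Longrightarrow>
      (\<exists>r u v. r \<noteq> 0 \<and> deg_in y r = 0 \<and> r = u * G + v * B \<and>
        (\<forall>j\<in>{x, y}. deg_in j u \<le> K \<and> deg_in j v \<le> K))"
    and q: "K + \<alpha> < q"
  shows "irreducible (A + B * M)"
proof -
  note M_facts = xy \<tau> cd(1-3) M_def
  have \<alpha>: "\<alpha> < q" using q by simp
  obtain m where m: "m \<in> keys B" using B(3) keys_eq_empty_iff by blast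
  have "deg_in y (A + B * M) > 0"
  proof -
    have "d \<le> lookup (m + single y d) y" by (simp add: lookup_add)
    also have "\<dots> \<le> deg_in y (A + B * M)"
      by (rule le_deg_in[OF key_y[OF M_facts A B(1,2) \<alpha> m]])
    finally show ?thesis using cd by simp
  qed
  then have P: "A + B * M \<noteq> 0" "\<not> A + B * M dvd 1" by (auto simp: unit_iff_deg_in_0)
  have no_factor: False
    if FG: "A + B * M = F * G" and G: "\<not> G dvd 1" "deg_in x G \<le> \<alpha>" "deg_in y G \<le> 3 * \<alpha>" for F G
  proof (cases "deg_in y G = 0")
    case True
    have "deg_in y A < deg_in y M" using A \<alpha> cd by (simp add: deg_in_M[OF M_facts])
    then show False
      using not_dvd_monic_of_deg_in_0[OF True G(1) B(4) lead_in_M[OF M_facts]] FG by simp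
  next
    case False
    have "rel_prime G B"
      unfolding rel_prime_def
    proof (intro allI impI)
      fix t assume t: "t dvd G" "t dvd B"
      then have "t dvd A + B * M" by (simp add: FG)
      then have "t dvd A" using t by (metis dvd_add_left_iff dvd_mult2)
      then show "t dvd 1" using t B(4) by (simp add: rel_prime_def)
    qed
    moreover have "G \<noteq> 0" using False by auto
    ultimately have "\<exists>r u v. r \<noteq> 0 \<and> deg_in y r = 0 \<and> r = u * G + v * B"
      using rel_prime_imp_elimination[of G B y] by metis
    moreover have "deg_in y G + deg_in y B \<le> 4 * \<alpha>" using G(3) B(2) by simp
    ultimately obtain r u v where r: "r \<noteq> 0" "deg_in y r = 0" "r = u * G + v * B"
        and uv: "deg_in x u \<le> K" "deg_in x v \<le> K" "deg_in y v \<le> K"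
      using K[of G B] G(2) B(1) by auto
    have eq: "v * A + r * M = G * (v * F + u * M)"
    proof -
      have "v * A + r * M = v * (A + B * M) + u * G * M" by (simp add: r(3) algebra_simps)
      then show ?thesis by (simp add: FG algebra_simps)
    qed
    have vA: "deg_in x (v * A) \<le> K + \<alpha>" "deg_in y (v * A) \<le> K + \<alpha>"
      using deg_in_mult_le[of x v A] deg_in_mult_le[of y v A] uv A by linarith+
    have rx: "deg_in x r \<le> K + \<alpha>"
      unfolding r(3) using deg_in_mult_le[of x u G] deg_in_mult_le[of x v B] uv G B
      by (intro deg_in_add) linarith+
    have ry: "deg_in y r \<le> K + \<alpha>" using r(2) by simp
    have "deg_in y G * q \<le> 3 * \<alpha> * q" using G(3) by (rule mult_le_mono1)
    then have "deg_in y G * q < d - 1" using cd(4) by (rule le_less_trans)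
    moreover have "deg_in x G < q" using G(2) \<alpha> by simp
    \<comment> \<open>\<open>no_small_factor\<close> is applied to \<open>v * A\<close> and
      \<open>r\<close> in place of \<open>A\<close> and \<open>B\<close>, with degree bound
      \<open>K + \<alpha>\<close>.\<close>
    ultimately show False
      using no_small_factor[OF M_facts vA rx ry q eq r(1,2)] False by simp
  qed
  show ?thesis
  proof (rule irreducibleI[OF P], rule ccontr)
    fix F G assume FG: "A + B * M = F * G" and "\<not> (F dvd 1 \<or> G dvd 1)"
    then show False
      using factor_deg_in_bounds[OF M_facts A B(1,2) \<alpha> FG B(3,4)]
        no_factor[of F G] no_factor[of G F] by (auto simp: mult.commute)
  qed
qed

section \<open>Choice of the constants and of the sparse polynomial\<close>

theorem theorem1p3:
  fixes s :: nat
    and A B :: "nat \<Rightarrow> ('n::finite, 'k::field) mvpoly"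
  assumes "CARD('n) \<ge> 2"
    and "\<And>i. i \<in> {1..s} \<Longrightarrow> A i \<noteq> 0"
    and "\<And>i. i \<in> {1..s} \<Longrightarrow> B i \<noteq> 0"
    and "\<And>i. i \<in> {1..s} \<Longrightarrow> rel_prime (A i) (B i)"
  shows "\<exists>d\<^sub>0::nat. d\<^sub>0 \<ge> 1 \<and>
    (\<forall>d :: 'n \<Rightarrow> nat. (\<forall>j. d j > d\<^sub>0) \<longrightarrow>
      (\<exists>M :: ('n, 'k) mvpoly.
        irreducible M \<and>
        (\<forall>i\<in>{1..s}. irreducible (A i + B i * M)) \<and>
        (\<forall>j. deg_in j M = d j)))"
proof -
  define \<alpha> where "\<alpha> = (\<Sum>i\<in>{1..s}. \<Sum>j\<in>UNIV. deg_in j (A i) + deg_in j (B i))"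
  have \<alpha>: "deg_in j (A i) \<le> \<alpha>" "deg_in j (B i) \<le> \<alpha>" if "i \<in> {1..s}" for i j
  proof -
    have "deg_in j (A i) + deg_in j (B i) \<le> (\<Sum>j\<in>UNIV. deg_in j (A i) + deg_in j (B i))"
      by (rule member_le_sum) auto
    also have "\<dots> \<le> \<alpha>" unfolding \<alpha>_def using that by (intro member_le_sum) auto
    finally show "deg_in j (A i) \<le> \<alpha>" "deg_in j (B i) \<le> \<alpha>" by auto
  qed
  define E :: "'n \<Rightarrow> 'n \<Rightarrow> nat \<Rightarrow> bool" where "E x y K \<longleftrightarrow> (\<forall>G B :: ('n, 'k) mvpoly.
      deg_in y G + deg_in y B \<le> 4 * \<alpha> \<longrightarrow> deg_in x G \<le> \<alpha> \<longrightarrow> deg_in x B \<le> \<alpha> \<longrightarrow>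
      (\<exists>r u v. r \<noteq> 0 \<and> deg_in y r = 0 \<and> r = u * G + v * B) \<longrightarrow>
      (\<exists>r u v. r \<noteq> 0 \<and> deg_in y r = 0 \<and> r = u * G + v * B \<and>
        (\<forall>j\<in>{x, y}. deg_in j u \<le> K \<and> deg_in j v \<le> K)))" for x y K
  have "\<exists>K. x \<noteq> y \<longrightarrow> E x y K" for x y
    using bounded_elimination[of x y "4 * \<alpha>" \<alpha>] unfolding E_def by blast
  then obtain K where K: "x \<noteq> y \<Longrightarrow> E x y (K x y)" for x y by metis
  \<comment> \<open>The variables \<open>x\<close> and \<open>y\<close> depend on \<open>d\<close>,
    so \<open>q\<close> must exceed the bounds for all pairs of variables.\<close>
  define q where "q = (\<Sum>x\<in>UNIV. \<Sum>y\<in>UNIV. K x y) + \<alpha> + 1"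
  have q: "K x y + \<alpha> < q" for x y
  proof -
    have "K x y \<le> (\<Sum>y\<in>UNIV. K x y)" by (rule member_le_sum) auto
    also have "\<dots> \<le> (\<Sum>x\<in>UNIV. \<Sum>y\<in>UNIV. K x y)" by (rule member_le_sum) auto
    finally show ?thesis by (simp add: q_def)
  qed
  define d0 where "d0 = 3 * \<alpha> * q + 2 * q + 1"
  have "\<exists>M :: ('n, 'k) mvpoly. irreducible M \<and>
      (\<forall>i\<in>{1..s}. irreducible (A i + B i * M)) \<and> (\<forall>j. deg_in j M = d j)"
    if d: "\<forall>j. d j > d0" for d :: "'n \<Rightarrow> nat"
  proof -
    obtain a b :: 'n where "a \<noteq> b" 
      using assms(1) card_le_Suc0_iff_eq[of "UNIV :: 'n set"] by force
    then obtain x y where xy: "x \<noteq> y" "d y \<le> d x" by (metis nat_le_linear)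
    define \<tau> where "\<tau> = Abs_poly_mapping (\<lambda>j. if j = y then 0 else d j)"
    have \<tau>: "lookup \<tau> j = (if j = y then 0 else d j)" for j by (simp add: \<tau>_def)
    define c where "c = d x + 1 + q - d y"
    define M :: "('n, 'k) mvpoly"
      where "M = var_pow y (d y) + single (\<tau> + single y (d y - 1)) 1 + var_pow x c"
    have dy: "2 * q < d y" "3 * \<alpha> * q < d y - 1" using d[rule_format, of y] by (auto simp: d0_def)
    have cd: "c + d y = d x + 1 + q" using xy by (simp add: c_def)
    note M_facts = xy(1) _ _ cd xy(2) dy(1)
    have irr: "irreducible (C + D * M)"
      if "deg_in x C \<le> \<alpha>" "deg_in y C \<le> \<alpha>" "deg_in x D \<le> \<alpha>" "deg_in y D \<le> \<alpha>"
        "D \<noteq> 0" "rel_prime C D" for C D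
      by (rule irreducible_add_mult_sparse[OF M_facts dy(2) M_def that _ q[of x y]])
        (use K[OF xy(1)] xy in \<open>auto simp: \<tau> E_def\<close>)
    \<comment> \<open>\<open>M\<close> itself is covered by the pair \<open>(0, 1)\<close>.\<close>
    have "irreducible (0 + 1 * M)" by (rule irr) (auto simp: rel_prime_def)
    then have "irreducible M" by simp
    moreover have "irreducible (A i + B i * M)" if "i \<in> {1..s}" for i
      by (rule irr) (use \<alpha> that assms in auto)
    moreover have "deg_in j M = d j" for j
    proof (rule antisym)
      have "deg_in j (var_pow y (d y) :: ('n, 'k) mvpoly) \<le> d j"
        "deg_in j (single (\<tau> + single y (d y - 1)) 1 :: ('n, 'k) mvpoly) \<le> d j"
        "deg_in j (var_pow x c :: ('n, 'k) mvpoly) \<le> d j"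
        using dy xy by (auto simp: deg_in_var_pow deg_in_single lookup_add lookup_single when_def \<tau> c_def)
      then show "deg_in j M \<le> d j" unfolding M_def by (intro deg_in_add)
      have 0: "deg_in x (0 :: ('n, 'k) mvpoly) \<le> 0" "deg_in y (0 :: ('n, 'k) mvpoly) \<le> 0"
        "deg_in x (1 :: ('n, 'k) mvpoly) \<le> 0" "deg_in y (1 :: ('n, 'k) mvpoly) \<le> 0" "0 < q"
        by (auto simp: q_def)
      have t: "lookup \<tau> x = d x" "lookup \<tau> y = 0" using xy by (auto simp: \<tau>)
      \<comment> \<open>With \<open>A = 0\<close>, \<open>B = 1\<close> and degree bound 0, the key
        lemmas show that two terms of \<open>M\<close> survive; together they attain all the
        degrees.\<close>
      have "single y (d y) \<in> keys M" "\<tau> + single y (d y - 1) \<in> keys M"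
        using key_y[OF xy(1) t cd xy(2) dy(1) M_def 0, of 0]
          key_xy[OF xy(1) t cd xy(2) dy(1) M_def 0, of 0] by simp_all
      from this[THEN le_deg_in, of j] show "d j \<le> deg_in j M"
        by (cases "j = y") (auto simp: lookup_add lookup_single \<tau>)
    qed
    ultimately show ?thesis by blast
  qed
  moreover have "d0 \<ge> 1" by (simp add: d0_def)
  ultimately show ?thesis by blast
qed

end
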